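(* Up to affine equivalence, there exist exactly $15$ (invariant) affine structures on the $3$-dimensional real abelian Lie algebra. They are represented by the structures $A_1,\dots,A_{15}$ whose associated affine actions on $\mathbb R^3$ are given, for parameters $a,b,c\in\mathbb R$, by sending $(x,y,z)$ to: - $A_1$: $\big(e^{a}x+e^{a}-1,\ e^{a}(e^{b}-1)x+e^{a+b}y+e^{a}(e^{b}-1),\ e^{a}(e^{c}-1)x+e^{a+c}z+e^{a}(e^{c}-1)\big)$; - $A_2$: $\big(xe^{a}\cos c-ze^{a}\sin c+e^{a}\cos c-1,\ (e^{a+b}-e^{a}\cos c)x+e^{a+b}y+ze^{a}\sin c-e^{a}\cos c+e^{a+b},\ xe^{a}\sin c+ze^{a}\cos c+e^{a}\sin c\big)$; - $A_3$: $\big(e^{a}x+e^{a}-1,\ e^{a}(e^{b}-1)x+e^{a+b}y+e^{a}(e^{b}-1),\ ce^{a}x+e^{a}z+ce^{a}\big)$; - $A_4$: $\big(e^{a}x+e^{a}-1,\ (b+\tfrac{c^2}{2})e^{a}x+e^{a}y+ce^{a}z+(b+\tfrac{c^2}{2})e^{a},\ ce^{a}x+e^{a}z+ce^{a}\big)$; - $A_5$: $\big(e^{a}x+e^{a}-1,\ be^{a}x+e^{a}y+be^{a},\ ce^{a}x+e^{a}z+ce^{a}\big)$; - $A_6$: $\big(e^{a}x+e^{a}-1,\ e^{b}y+e^{b}-1,\ z+c\big)$; - $A_7$: $\big(xe^{a}\cos b-ye^{a}\sin b+e^{a}\cos b-1,\ xe^{a}\sin b+ye^{a}\cos b+e^{a}\sin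 b,\ z+c\big)$; - $A_8$: $\big(e^{a}x+e^{a}-1,\ y+b,\ z+c\big)$; - $A_9$: $\big(e^{a}x+e^{a}-1,\ be^{a}x+e^{a}y+be^{a},\ z+c\big)$; - $A_{10}$: $\big(e^{a}x+e^{a}-1,\ y+b,\ by+z+\tfrac{b^2}{2}+c\big)$; - $A_{11}$: $\big(x+a,\ ax+y+cz+b+\tfrac12(a^2+c^2),\ z+c\big)$; - $A_{12}$: $\big(x+a,\ ax+y-cz+b+\tfrac12(a^2-c^2),\ z+c\big)$; - $A_{13}$: $\big(x+a,\ ax+y+b+\tfrac{a^2}{2},\ z+c\big)$; - $A_{14}$: $\big(x+a,\ ax+y+b+\tfrac{a^2}{2},\ (b+\tfrac{a^2}{2})x+ay+z+\tfrac{a^3}{6}+ab+c\big)$; - $A_{15}$: $\big(x+a,\ y+b,\ z+c\big)$. Among these, only the structures $A_{11},\dots,A_{15}$ are complete.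
   Context: Let $\mathfrak g$ be a real Lie algebra of dimension $n$ and $\mathrm{aff}(\mathbb R^n)=\left\{\begin{pmatrix}A&b\\0&0\end{pmatrix}: A\in\mathfrak{gl}(n,\mathbb R),\ b\in\mathbb R^n\right\}$. An affine structure on $\mathfrak g$ is a Lie algebra morphism $\Psi:\mathfrak g\to\mathrm{aff}(\mathbb R^n)$, $\Psi(X)=\begin{pmatrix}A(X)&b(X)\\0&0\end{pmatrix}$, with $b:\mathfrak g\to\mathbb R^n$ a linear bijection. It defines a product on $\mathfrak g$ by $X\cdot Y=b^{-1}(A(X)b(Y))$, which is commutative and associative (not necessarily unitary) when $\mathfrak g$ is abelian. Conversely, a commutative associative product on the abelian Lie algebra $\mathbb R^n$ gives the affine structure $X\mapsto\begin{pmatrix}L_X&X\\0&0\end{pmatrix}$, $L_X(Y)=X\cdot Y$. Two affine structures on an abelian Lie algebra are affinely equivalent if and only if the corresponding commutative associative real algebras are isomorphic; this is taken as the definition of affine equivalence. The affine action associated with an affine structure $\Psi$ on the abelian Lie algebra $\mathbb R^3$ (with basis $e_1,e_2,e_3$) is the action of the group $\mathbb R^3$ on $\mathbb R^3$ in which $(a,b,c)$ acts by the affine transformation with matrix $\exp\Psi(ae_1+be_2+ce_3)$. Here a matrix $\begin{pmatrix}A&b\\0&1\end{pmatrix}$ acts by $v\mapsto Av+b$. An affine structure is complete if, for every $X\in\mathfrak g$, the endomorphism $Y\mapsto Y+Y\cdot X$ of the vector space $\mathfrak g$ is bijective. *)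

theory Defs
  imports "HOL-Analysis.Analysis"
begin

text \<open>
  Square matrices of size \<open>n + 1\<close> are indexed by \<^typ>\<open>'n option\<close>: the indices \<^term>\<open>Some i\<close>
  are the first \<open>n\<close> rows and columns, \<^term>\<open>None\<close> is the last one.
\<close>

type_synonym 'n block_matrix = "(real ^ ('n option)) ^ ('n option)"

definition linear_part :: "'n::finite block_matrix \<Rightarrow> real ^ 'n ^ 'n"
  where "linear_part M = (\<chi> i j. M $ Some i $ Some j)"

definition translation_part :: "'n::finite block_matrix \<Rightarrow> real ^ 'n"
  where "translation_part M = (\<chi> i. M $ Some i $ None)"

definition aff :: "'n::finite block_matrix set"
  where "aff = {M. \<forall>j. M $ None $ j = 0}"

definition lie_bracket :: "('g::real_vector \<Rightarrow> 'g \<Rightarrow> 'g) \<Rightarrow> bool"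
  where "lie_bracket br \<longleftrightarrow> bilinear br \<and> (\<forall>X. br X X = 0) \<and>
    (\<forall>X Y Z. br X (br Y Z) + br Y (br Z X) + br Z (br X Y) = 0)"

definition abelian_bracket :: "'g::real_vector \<Rightarrow> 'g \<Rightarrow> 'g"
  where "abelian_bracket X Y = 0"

text \<open>The bijectivity of the translation part forces the Lie algebra to have dimension \<open>n\<close>.\<close>

definition affine_structure ::
    "('g::real_vector \<Rightarrow> 'g \<Rightarrow> 'g) \<Rightarrow> ('g \<Rightarrow> 'n::finite block_matrix) \<Rightarrow> bool"
  where "affine_structure br \<Psi> \<longleftrightarrow>
    lie_bracket br \<and>
    linear \<Psi> \<and> range \<Psi> \<subseteq> aff \<and>
    (\<forall>X Y. \<Psi> (br X Y) = \<Psi> X ** \<Psi> Y - \<Psi> Y ** \<Psi> X) \<and>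
    bij (\<lambda>X. translation_part (\<Psi> X))"

definition affine_product :: "('g::real_vector \<Rightarrow> 'n::finite block_matrix) \<Rightarrow> 'g \<Rightarrow> 'g \<Rightarrow> 'g"
  where "affine_product \<Psi> X Y =
    inv (\<lambda>Z. translation_part (\<Psi> Z)) (linear_part (\<Psi> X) *v translation_part (\<Psi> Y))"

definition complete_structure :: "('g::real_vector \<Rightarrow> 'n::finite block_matrix) \<Rightarrow> bool"
  where "complete_structure \<Psi> \<longleftrightarrow> (\<forall>X. bij (\<lambda>Y. Y + affine_product \<Psi> Y X))"

text \<open>Affine equivalence is isomorphism of the associated algebras, on the abelian Lie algebra only.\<close>

definition affine_equivalence ::
    "(('g::real_vector \<Rightarrow> 'n::finite block_matrix) \<times> ('g \<Rightarrow> 'n block_matrix)) set"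
  where "affine_equivalence = {(\<Psi>, \<Phi>).
    affine_structure abelian_bracket \<Psi> \<and> affine_structure abelian_bracket \<Phi> \<and>
    (\<exists>f. linear f \<and> bij f \<and>
      (\<forall>X Y. f (affine_product \<Psi> X Y) = affine_product \<Phi> (f X) (f Y)))}"

text \<open>
  The exponential of the library needs a normed algebra with unit, which \<^typ>\<open>real ^ 'm ^ 'm\<close>
  with the matrix product \<open>**\<close> is not an instance of.
\<close>

definition matrix_exp :: "real ^ 'm ^ 'm \<Rightarrow> real ^ 'm ^ 'm"
  where "matrix_exp M = (\<Sum>k. (1 / fact k) *\<^sub>R ((\<lambda>N. M ** N) ^^ k) (mat 1))"

definition affine_action ::
    "('g::real_vector \<Rightarrow> 'n::finite block_matrix) \<Rightarrow> 'g \<Rightarrow> real ^ 'n \<Rightarrow> real ^ 'n"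
  where "affine_action \<Psi> g v =
    linear_part (matrix_exp (\<Psi> g)) *v v + translation_part (matrix_exp (\<Psi> g))"

end

(*
  An affine structure on an abelian Lie algebra is determined up to equivalence by its
  commutative associative product, so the task is to classify such algebras in dimension 3.
  By finite dimensionality an element x with x^4 nonzero has a nonzero idempotent among its
  multiples.  Hence for an idempotent e that is orthogonal to no other nonzero one the Peirce
  decomposition splits the algebra as eA + (1-e)A with eA unital and (1-e)A nil, and the
  rank of e (0, 1, 2 or 3) leaves few possibilities for each factor.  For a unital algebra of
  dimension 3, either a nontrivial idempotent splits it again, or it is local and, since every
  multiplication operator has a real eigenvalue, it is the unit plus a nil ideal of dimension 2.
  The normal forms are told apart by units, idempotents and the vanishing of small products.

  If A is the algebra of an affine structure and 1 + b = exp X in its unital extension, then X acts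
  by v |-> v + b v + b; this yields the explicit actions from the solution of b' = X + X b.
*)

theory Submission
  imports Defs
begin

subsection \<open>The matrix exponential as the value of a flow\<close>

text \<open>The count is 5 + 3 + 2 + 5: unital algebras give 1 to 5, a maximal idempotent of rank 2
  gives 6, 7 and 9, rank 1 gives 8 and 10, and nil algebras give 11 to 15. The real field matters in
  two places: completing the square in a two-dimensional unital algebra, and scaling the last basis
  vector of a nil algebra. The remaining constant can only be rescaled by positive factors, so its
  sign survives; this separates 1 from 2, 6 from 7 and 11 from 12.

  A unit need not exist, so the image of \<open>1 - e\<close> is replaced by the kernel of
  multiplication by \<open>e\<close>, and nilpotency is expressed by the fixed power 4, one more
  than the dimension. Completeness reflects the absence of idempotents: for a nonzero idempotent
  \<open>e\<close> the map \<open>Y + Y X\<close> with \<open>X = - e\<close> kills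
  \<open>Y = e\<close>.

  The exponential is given as a series. Instead of computing powers of the matrices, closed-form
  curves are checked against the flow equation, and a Taylor estimate shows that every solution of
  it ends at the exponential.\<close>

lemma matrix_exp_eqI:
  fixes F :: "real \<Rightarrow> real ^ 'm ^ 'm"
  assumes F0: "F 0 = mat 1"
    and F': "\<And>t. (F has_vector_derivative M ** F t) (at t)"
  shows "matrix_exp M = F 1"
proof -
  \<comment> \<open>\<open>P k\<close> is left multiplication by the k-th power of \<open>M\<close>;
    applied to \<open>F t\<close> it gives the k-th derivative of \<open>F\<close>.\<close>
  define P :: "nat \<Rightarrow> real ^ 'm ^ 'm \<Rightarrow> real ^ 'm ^ 'm"
    where "P k = ((\<lambda>N. M ** N) ^^ k)" for k
  have lin: "linear ((**) M :: real ^ 'm ^ 'm \<Rightarrow> real ^ 'm ^ 'm)"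
    by (intro linearI) (simp_all add: matrix_add_ldistrib matrix_scalar_ac scalar_matrix_assoc)
  have linP: "linear (P k)" for k
    unfolding P_def
    by (induction k)
      (auto intro!: linear_compose lin
        simp: id_def linear_iff linear_add[OF lin] linear_scale[OF lin])
  have P_M: "P k (M ** N) = P (Suc k) N" for k N
    by (simp add: P_def funpow_Suc_right del: funpow.simps)
  obtain K where K: "K > 0" "\<And>N :: real ^ 'm ^ 'm. norm (M ** N) \<le> norm N * K"
    using bounded_linear.pos_bounded[OF linear_conv_bounded_linear[THEN iffD1, OF lin]] by auto
  have nP: "norm (P k N) \<le> K ^ k * norm N" for k N
  proof (induction k)
    case (Suc k)
    have "norm (P (Suc k) N) \<le> norm (P k N) * K" using K(2) by (simp add: P_def)
    also have "\<dots> \<le> (K ^ k * norm N) * K" using Suc K(1) by (intro mult_right_mono) auto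
    finally show ?case by (simp add: mult_ac)
  qed (simp add: P_def)
  \<comment> \<open>The Lagrange remainder below is evaluated at an unknown point of [-1, 1], hence
    a bound for \<open>F\<close> on all of that interval.\<close>
  have "continuous_on (cball 0 1) F"
    using has_vector_derivative_continuous[OF F'] by (simp add: continuous_at_imp_continuous_on)
  then have "bounded (F ` cball 0 1)"
    by (intro compact_imp_bounded compact_continuous_image) auto
  then obtain B where B: "\<And>t. \<bar>t\<bar> \<le> 1 \<Longrightarrow> norm (F t) \<le> B"
    unfolding bounded_iff by (metis dist_0_norm imageI mem_cball real_norm_def)
  have entry: "(\<lambda>k. ((1 / fact k) *\<^sub>R P k (mat 1)) $ i $ j) sums (F 1 $ i $ j)" for i j
  proof -
    have der: "DERIV (\<lambda>t. P k (F t) $ i $ j) t :> P (Suc k) (F t) $ i $ j" for k t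
    proof -
      have "bounded_linear (\<lambda>N. P k N $ i $ j)"
        using linP by (intro bounded_linear_compose[OF bounded_linear_vec_nth]) (simp add: linear_conv_bounded_linear)
      from bounded_linear.has_vector_derivative[OF this F'] show ?thesis
        by (simp add: P_M has_real_derivative_iff_has_vector_derivative)
    qed
    \<comment> \<open>Because \<open>F 0\<close> is the identity, the Taylor sums of
      \<open>F\<close> at 0, taken at time 1, are exactly the partial sums of the exponential
      series.\<close>
    have rem: "\<bar>F 1 $ i $ j - (\<Sum>k<n. ((1 / fact k) *\<^sub>R P k (mat 1)) $ i $ j)\<bar> \<le> B * (K ^ n / fact n)" for n
    proof -
      obtain t where t: "\<bar>t\<bar> \<le> \<bar>1::real\<bar>" and
        eq: "F 1 $ i $ j = (\<Sum>k<n. P k (F 0) $ i $ j / fact k * 1 ^ k) + P n (F t) $ i $ j / fact n * 1 ^ n"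
        using Maclaurin_all_le[of "\<lambda>k t. P k (F t) $ i $ j" "\<lambda>t. F t $ i $ j" 1 n] der
        by (auto simp: P_def)
      have "\<bar>P n (F t) $ i $ j\<bar> \<le> norm (P n (F t))"
        using component_le_norm_cart[of "P n (F t) $ i" j] Finite_Cartesian_Product.norm_nth_le[of "P n (F t)" i]
        by linarith
      also have "\<dots> \<le> K ^ n * norm (F t)" by (rule nP)
      also have "\<dots> \<le> K ^ n * B" using K(1) B t by (intro mult_left_mono) auto
      finally have "\<bar>P n (F t) $ i $ j / fact n\<bar> \<le> B * (K ^ n / fact n)"
        by (simp add: field_simps)
      then show ?thesis by (simp add: eq F0 )
    qed
    have "(\<lambda>n. K ^ n / fact n) \<longlonglongrightarrow> 0"
      using summable_LIMSEQ_zero[OF summable_exp[of K]] by (simp add: divide_inverse mult.commute)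
    from tendsto_mult[OF tendsto_const[of B] this]
    have "(\<lambda>n. B * (K ^ n / fact n)) \<longlonglongrightarrow> 0"
      by simp
    then have "(\<lambda>n. F 1 $ i $ j - (\<Sum>k<n. ((1 / fact k) *\<^sub>R P k (mat 1)) $ i $ j)) \<longlonglongrightarrow> 0"
      by (rule Lim_null_comparison[rotated, where g = "\<lambda>n. B * (K ^ n / fact n)"]) (use rem in auto)
    from tendsto_diff[OF tendsto_const[of "F 1 $ i $ j"] this] show ?thesis
      by (simp add: sums_def)
  qed
  have "(\<lambda>k. (1 / fact k) *\<^sub>R P k (mat 1)) sums F 1"
    unfolding sums_def
    by (rule vec_tendstoI)+ (use entry in \<open>simp add: sums_def\<close>)
  then show ?thesis
    by (simp add: matrix_exp_def P_def sums_iff)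
qed

subsection \<open>Affine structures and commutative associative products\<close>

text \<open>The corner entry is a parameter because both the Lie algebra (corner 0) and the group
  containing the exponentials (corner 1) are needed.\<close>

definition affine_matrix :: "real ^ 'n ^ 'n \<Rightarrow> real ^ 'n \<Rightarrow> real \<Rightarrow> 'n::finite block_matrix"
  where "affine_matrix L b r = (\<chi> i j.
    case i of None \<Rightarrow> (case j of None \<Rightarrow> r | Some _ \<Rightarrow> 0)
    | Some k \<Rightarrow> (case j of None \<Rightarrow> b $ k | Some l \<Rightarrow> L $ k $ l))"

lemma linear_part_affine_matrix [simp]: "linear_part (affine_matrix L b r) = L"
  and translation_part_affine_matrix [simp]: "translation_part (affine_matrix L b r) = b"
  by (simp_all add: linear_part_def translation_part_def affine_matrix_def vec_eq_iff)

lemma affine_matrix_eq_iff: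
  "affine_matrix L b r = affine_matrix L' b' r' \<longleftrightarrow> L = L' \<and> b = b' \<and> r = r'"
  by (auto simp: affine_matrix_def vec_eq_iff split: option.splits)

lemma aff_iff: "M \<in> aff \<longleftrightarrow> M = affine_matrix (linear_part M) (translation_part M) 0"
proof
  assume "M \<in> aff"
  then show "M = affine_matrix (linear_part M) (translation_part M) 0"
    by (auto simp: aff_def affine_matrix_def vec_eq_iff linear_part_def translation_part_def
        split: option.splits)
next
  assume M: "M = affine_matrix (linear_part M) (translation_part M) 0"
  show "M \<in> aff"
    by (subst M) (auto simp: aff_def affine_matrix_def split: option.splits)
qed

lemma mat_1_eq_affine_matrix: "(mat 1 :: 'n::finite block_matrix) = affine_matrix (mat 1) 0 1"
  by (auto simp: affine_matrix_def vec_eq_iff mat_def split: option.splits)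

lemma affine_matrix_add:
  "affine_matrix L b r + affine_matrix L' b' r' = affine_matrix (L + L') (b + b') (r + r')"
  and affine_matrix_scaleR:
  "c *\<^sub>R affine_matrix L b r = affine_matrix (c *\<^sub>R L) (c *\<^sub>R b) (c * r)"
  by (auto simp: affine_matrix_def vec_eq_iff split: option.splits)

lemma sum_option: "(\<Sum>k\<in>UNIV. f k) = f None + (\<Sum>k\<in>UNIV. f (Some k))"
  for f :: "'n::finite option \<Rightarrow> 'a::comm_monoid_add"
  by (simp add: UNIV_option_conv sum.insert sum.reindex)

lemma affine_matrix_mult:
  "affine_matrix L b r ** affine_matrix L' b' r' = affine_matrix (L ** L') (L *v b' + r' *\<^sub>R b) (r * r')"
  by (auto simp: affine_matrix_def vec_eq_iff matrix_matrix_mult_def matrix_vector_mult_def sum_option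
      split: option.splits)

locale commutative_associative =
  fixes p :: "'v::real_vector \<Rightarrow> 'v \<Rightarrow> 'v" (infixl "\<cdot>" 70)
  assumes bilinear: "bilinear p"
    and commute: "p x y = p y x"
    and assoc: "p (p x y) z = p x (p y z)"

lemma abelian_affine_structure_iff:
  "affine_structure abelian_bracket \<Psi> \<longleftrightarrow> linear \<Psi> \<and> range \<Psi> \<subseteq> aff \<and>
    (\<forall>X Y. \<Psi> X ** \<Psi> Y = \<Psi> Y ** \<Psi> X) \<and> bij (\<lambda>X. translation_part (\<Psi> X))"
proof -
  have "lie_bracket abelian_bracket"
    by (auto simp: lie_bracket_def abelian_bracket_def bilinear_def linear_iff)
  moreover have "\<Psi> (abelian_bracket X Y) = 0" if "linear \<Psi>" for X Y
    using that by (simp add: abelian_bracket_def linear_0)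
  ultimately show ?thesis
    unfolding affine_structure_def by auto
qed

text \<open>The vanishing commutator splits into two blocks: the linear parts commute, and
  \<open>L X\<close> applied to \<open>b Y\<close> is symmetric in \<open>X\<close> and
  \<open>Y\<close>. The second is commutativity of the product, and together they give
  associativity. All identities are checked after applying the injective map
  \<open>b\<close>.\<close>

lemma commutative_associative_affine_product:
  fixes \<Psi> :: "'g::real_vector \<Rightarrow> 'n::finite block_matrix"
  assumes "affine_structure abelian_bracket \<Psi>"
  shows "commutative_associative (affine_product \<Psi>)"
proof -
  define b where "b X = translation_part (\<Psi> X)" for X
  define L where "L X = linear_part (\<Psi> X)" for X
  let ?p = "affine_product \<Psi>"
  have lin: "linear \<Psi>" and aff: "\<And>X. \<Psi> X \<in> aff" and "bij b"
    and comm: "\<And>X Y. \<Psi> X ** \<Psi> Y = \<Psi> Y ** \<Psi> X"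
    using assms by (auto simp: abelian_affine_structure_iff b_def[abs_def])
  have \<Psi>: "\<Psi> X = affine_matrix (L X) (b X) 0" for X
    using aff by (simp add: aff_iff L_def b_def)
  have LL: "L X ** L Y = L Y ** L X" and Lb: "L X *v b Y = L Y *v b X" for X Y
    using comm[of X Y] by (simp_all add: \<Psi> affine_matrix_mult affine_matrix_eq_iff)
  have bp: "b (?p X Y) = L X *v b Y" for X Y
    using surj_f_inv_f[OF bij_is_surj[OF \<open>bij b\<close>]] by (simp add: affine_product_def L_def b_def[abs_def])
  have inj: "X = Y" if "b X = b Y" for X Y
    using that \<open>bij b\<close> by (simp add: bij_is_inj inj_eq)
  have linb: "linear b" and linL: "linear L"
    using lin by (auto simp: linear_iff b_def L_def translation_part_def linear_part_def vec_eq_iff)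
  note b = linear_add[OF linb] linear_scale[OF linb] and L = linear_add[OF linL] linear_scale[OF linL]
  show ?thesis
  proof
    show "bilinear ?p"
      by (auto simp: bilinear_def linear_iff bp b L algebra_simps scaleR_matrix_vector_assoc
          matrix_vector_mult_add_rdistrib matrix_vector_right_distrib matrix_vector_mult_scaleR intro!: inj)
    show comm_p: "?p X Y = ?p Y X" for X Y
      by (rule inj) (simp add: bp Lb)
    show "?p (?p X Y) Z = ?p X (?p Y Z)" for X Y Z
    proof (rule inj)
      have "b (?p (?p X Y) Z) = L Z *v (L X *v b Y)"
        by (subst comm_p) (simp add: bp)
      also have "\<dots> = L X *v (L Z *v b Y)"
        by (simp add: matrix_vector_mul_assoc LL)
      also have "\<dots> = b (?p X (?p Y Z))"
        by (simp add: bp Lb)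
      finally show "b (?p (?p X Y) Z) = b (?p X (?p Y Z))" .
    qed
  qed
qed

definition product_structure ::
    "(real ^ 'n \<Rightarrow> real ^ 'n \<Rightarrow> real ^ 'n) \<Rightarrow> real ^ 'n \<Rightarrow> 'n::finite block_matrix"
  where "product_structure p X = affine_matrix (matrix (p X)) X 0"

lemma bilinear_linear_right: "bilinear p \<Longrightarrow> linear (p x)"
  by (simp add: bilinear_def)

lemma matrix_bilinear_add: "bilinear p \<Longrightarrow> matrix (p (x + y)) = matrix (p x) + matrix (p y)"
  and matrix_bilinear_scaleR: "bilinear p \<Longrightarrow> matrix (p (c *\<^sub>R x)) = c *\<^sub>R matrix (p x)"
  for p :: "real ^ 'n \<Rightarrow> real ^ 'n \<Rightarrow> real ^ 'n"
  by (simp_all add: matrix_def vec_eq_iff bilinear_ladd bilinear_lmul)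

lemma linear_product_structure:
  assumes "bilinear p"
  shows "linear (product_structure p)"
  using assms by (simp add: linear_iff product_structure_def affine_matrix_add affine_matrix_scaleR
      matrix_bilinear_add matrix_bilinear_scaleR)

lemma affine_structure_product_structure:
  fixes p :: "real ^ 'n \<Rightarrow> real ^ 'n \<Rightarrow> real ^ 'n::finite"
  assumes "commutative_associative p"
  shows "affine_structure abelian_bracket (product_structure p)"
proof -
  interpret commutative_associative p by fact
  note lin = bilinear_linear_right[OF bilinear]
  have "linear (product_structure p)"
    by (rule linear_product_structure[OF bilinear])
  moreover have "matrix (p X) ** matrix (p Y) = matrix (p Y) ** matrix (p X)" for X Y
  proof -
    have "p X \<circ> p Y = p Y \<circ> p X"
      by (rule ext) (metis assoc commute comp_apply)
    then show ?thesis
      by (simp flip: matrix_compose[OF lin lin])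
  qed
  moreover have "(\<lambda>X. translation_part (product_structure p X)) = id"
    by (simp add: product_structure_def fun_eq_iff)
  ultimately show ?thesis
    unfolding abelian_affine_structure_iff
    by (auto simp: product_structure_def affine_matrix_mult aff_iff matrix_works lin commute)
qed

lemma affine_product_product_structure:
  assumes "bilinear p"
  shows "affine_product (product_structure p) = p"
proof -
  have "(\<lambda>X. translation_part (product_structure p X)) = id"
    by (simp add: product_structure_def fun_eq_iff)
  then show ?thesis
    using bilinear_linear_right[OF assms]
    by (simp add: affine_product_def fun_eq_iff matrix_works) (simp add: product_structure_def matrix_works)
qed

text \<open>The block matrix of \<open>X\<close> is multiplication by \<open>X\<close> on the unital
  extension, its last column being the image of the unit. Associativity therefore makes it
  multiplicative, which turns the matrix flow equation into one inside the algebra.\<close>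

lemma product_structure_mult:
  assumes "commutative_associative p"
  shows "product_structure p X ** product_structure p Y = product_structure p (p X Y)"
proof -
  interpret commutative_associative p by fact
  note lin = bilinear_linear_right[OF bilinear]
  have "p X \<circ> p Y = p (p X Y)"
    by (simp add: fun_eq_iff assoc)
  then have "matrix (p X) ** matrix (p Y) = matrix (p (p X Y))"
    by (simp flip: matrix_compose[OF lin lin])
  then show ?thesis
    by (simp add: product_structure_def affine_matrix_mult matrix_works lin)
qed

text \<open>
  In the unital extension of the algebra the exponential of \<open>X\<close> is \<open>1 + \<beta> 1\<close>, where
  \<open>1 + \<beta>\<close> solves the linear differential equation with coefficient \<open>X\<close>.
\<close>

lemma affine_action_product_structure:
  assumes ca: "commutative_associative p"
    and \<beta>0: "\<beta> 0 = 0"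
    and \<beta>': "\<And>t. (\<beta> has_vector_derivative X + p X (\<beta> t)) (at t)"
  shows "affine_action (product_structure p) X v = v + p (\<beta> 1) v + \<beta> 1"
proof -
  interpret commutative_associative p by fact
  let ?P = "product_structure p"
  have lin: "linear ?P"
    by (rule linear_product_structure[OF bilinear])
  have "matrix_exp (?P X) = mat 1 + ?P (\<beta> 1)"
  proof (rule matrix_exp_eqI[where F = "\<lambda>t. mat 1 + ?P (\<beta> t)"])
    show "mat 1 + ?P (\<beta> 0) = mat 1"
      by (simp add: \<beta>0 linear_0[OF lin])
    fix t
    have "((\<lambda>t. ?P (\<beta> t)) has_vector_derivative ?P (X + p X (\<beta> t))) (at t)"
      using bounded_linear.has_vector_derivative[OF _ \<beta>', of ?P] lin
      by (simp add: linear_conv_bounded_linear)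
    from has_vector_derivative_add[OF has_vector_derivative_const this]
    show "((\<lambda>t. mat 1 + ?P (\<beta> t)) has_vector_derivative ?P X ** (mat 1 + ?P (\<beta> t))) (at t)"
      by (simp add: matrix_add_ldistrib product_structure_mult ca linear_add[OF lin])
  qed
  then show ?thesis
    using bilinear_linear_right[OF bilinear]
    by (simp add: affine_action_def product_structure_def mat_1_eq_affine_matrix affine_matrix_add
        matrix_vector_mult_add_rdistrib matrix_works)
qed

lemma has_vector_derivative_vector_3:
  assumes "(f has_real_derivative f') F" "(g has_real_derivative g') F" "(h has_real_derivative h') F"
  shows "((\<lambda>t. vector [f t, g t, h t] :: real ^ 3) has_vector_derivative vector [f', g', h']) F"
proof -
  have eq: "vector [a, b, c] = a *\<^sub>R axis 1 1 + b *\<^sub>R axis 2 1 + c *\<^sub>R (axis 3 1 :: real ^ 3)" for a b c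
    by (simp add: vec_eq_iff forall_3 axis_def)
  show ?thesis
    unfolding eq using assms
    by (intro has_vector_derivative_add bounded_linear.has_vector_derivative[OF bounded_linear_scaleR_left])
      (simp_all add: has_real_derivative_iff_has_vector_derivative)
qed

subsection \<open>The fifteen normal forms and their affine actions\<close>

text \<open>The algebras are, with N a line with zero product and C the complex numbers: 1 is R x R
  x R; 2 is R x C; 3 is R x R[t]/(t^2); 4 is R[t]/(t^3); 5 is R[s,t]/(s,t)^2; 6 is R x R x N; 7 is C
  x N; 8 is R x N x N; 9 is R[t]/(t^2) x N; 10 is R times the ideal (t) of R[t]/(t^3); 11, 12 and 13
  are quadratic forms of signature (2,0), (1,1) and rank 1 with values in the second coordinate; 14
  is the ideal (t) of R[t]/(t^4); 15 is zero. In 1 to 5 the first basis vector is the unit of the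
  whole algebra, not of a factor. The last branch also catches every index outside 1 to 14.\<close>

definition normal_product :: "nat \<Rightarrow> real ^ 3 \<Rightarrow> real ^ 3 \<Rightarrow> real ^ 3" where
  "normal_product i X Y =
    (let a = X $ 1; b = X $ 2; c = X $ 3; x = Y $ 1; y = Y $ 2; z = Y $ 3
     in vector (
       if i = 1 then [a * x, b * x + (a + b) * y, c * x + (a + c) * z]
       else if i = 2 then [a * x - c * z, b * x + (a + b) * y + c * z, c * x + a * z]
       else if i = 3 then [a * x, b * x + (a + b) * y, c * x + a * z]
       else if i = 4 then [a * x, b * x + a * y + c * z, c * x + a * z]
       else if i = 5 then [a * x, b * x + a * y, c * x + a * z]
       else if i = 6 then [a * x, b * y, 0]
       else if i = 7 then [a * x - b * y, b * x + a * y, 0]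
       else if i = 8 then [a * x, 0, 0]
       else if i = 9 then [a * x, b * x + a * y, 0]
       else if i = 10 then [a * x, 0, b * y]
       else if i = 11 then [0, a * x + c * z, 0]
       else if i = 12 then [0, a * x - c * z, 0]
       else if i = 13 then [0, a * x, 0]
       else if i = 14 then [0, a * x, b * x + a * y]
       else [0, 0, 0]))"

lemma normal_product_simps:
  shows "normal_product 1 X Y = vector [X $ 1 * Y $ 1, X $ 2 * Y $ 1 + (X $ 1 + X $ 2) * Y $ 2, X $ 3 * Y $ 1 + (X $ 1 + X $ 3) * Y $ 3]"
  and "normal_product 2 X Y = vector [X $ 1 * Y $ 1 - X $ 3 * Y $ 3, X $ 2 * Y $ 1 + (X $ 1 + X $ 2) * Y $ 2 + X $ 3 * Y $ 3, X $ 3 * Y $ 1 + X $ 1 * Y $ 3]"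
  and "normal_product 3 X Y = vector [X $ 1 * Y $ 1, X $ 2 * Y $ 1 + (X $ 1 + X $ 2) * Y $ 2, X $ 3 * Y $ 1 + X $ 1 * Y $ 3]"
  and "normal_product 4 X Y = vector [X $ 1 * Y $ 1, X $ 2 * Y $ 1 + X $ 1 * Y $ 2 + X $ 3 * Y $ 3, X $ 3 * Y $ 1 + X $ 1 * Y $ 3]"
  and "normal_product 5 X Y = vector [X $ 1 * Y $ 1, X $ 2 * Y $ 1 + X $ 1 * Y $ 2, X $ 3 * Y $ 1 + X $ 1 * Y $ 3]"
  and "normal_product 6 X Y = vector [X $ 1 * Y $ 1, X $ 2 * Y $ 2, 0]"
  and "normal_product 7 X Y = vector [X $ 1 * Y $ 1 - X $ 2 * Y $ 2, X $ 2 * Y $ 1 + X $ 1 * Y $ 2, 0]"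
  and "normal_product 8 X Y = vector [X $ 1 * Y $ 1, 0, 0]"
  and "normal_product 9 X Y = vector [X $ 1 * Y $ 1, X $ 2 * Y $ 1 + X $ 1 * Y $ 2, 0]"
  and "normal_product 10 X Y = vector [X $ 1 * Y $ 1, 0, X $ 2 * Y $ 2]"
  and "normal_product 11 X Y = vector [0, X $ 1 * Y $ 1 + X $ 3 * Y $ 3, 0]"
  and "normal_product 12 X Y = vector [0, X $ 1 * Y $ 1 - X $ 3 * Y $ 3, 0]"
  and "normal_product 13 X Y = vector [0, X $ 1 * Y $ 1, 0]"
  and "normal_product 14 X Y = vector [0, X $ 1 * Y $ 1, X $ 2 * Y $ 1 + X $ 1 * Y $ 2]"
  and "normal_product 15 X Y = 0"
  by (simp_all add: normal_product_def Let_def vec_eq_iff forall_3)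

lemma le_15_cases:
  assumes "i \<in> {1..15 :: nat}"
  obtains "i = 1" | "i = 2" | "i = 3" | "i = 4" | "i = 5" | "i = 6" | "i = 7" | "i = 8" | "i = 9"
    | "i = 10" | "i = 11" | "i = 12" | "i = 13" | "i = 14" | "i = 15"
proof -
  have "i \<in> set [1..<16]" using assms by auto
  then show thesis using that by (auto simp: upt_rec)
qed

lemma commutative_associative_normal_product:
  assumes "i \<in> {1..15}"
  shows "commutative_associative (normal_product i)"
  using assms
  by (cases rule: le_15_cases; hypsubst; unfold_locales; unfold normal_product_simps bilinear_def linear_iff)
    (simp_all add: vec_eq_iff forall_3 algebra_simps)

text \<open>Reads the flow equation in coordinates, so that each normal form only requires three
  real functions and their derivatives.\<close>

lemma affine_action_normal_product:
  fixes f g h :: "real \<Rightarrow> real"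
  assumes i: "i \<in> {1..15}"
    and 0: "f 0 = 0" "g 0 = 0" "h 0 = 0"
    and f': "\<And>t. (f has_real_derivative (X + normal_product i X (vector [f t, g t, h t])) $ 1) (at t)"
    and g': "\<And>t. (g has_real_derivative (X + normal_product i X (vector [f t, g t, h t])) $ 2) (at t)"
    and h': "\<And>t. (h has_real_derivative (X + normal_product i X (vector [f t, g t, h t])) $ 3) (at t)"
  shows "affine_action (product_structure (normal_product i)) X v =
    v + normal_product i (vector [f 1, g 1, h 1]) v + vector [f 1, g 1, h 1]"
proof (rule affine_action_product_structure[OF commutative_associative_normal_product[OF i],
      where \<beta> = "\<lambda>t. vector [f t, g t, h t]"])
  show "vector [f 0, g 0, h 0] = (0 :: real ^ 3)"
    by (simp add: 0 vec_eq_iff forall_3)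
  fix t
  have "vector [v $ 1, v $ 2, v $ 3] = v" for v :: "real ^ 3"
    by (simp add: vec_eq_iff forall_3)
  with has_vector_derivative_vector_3[OF f' g' h']
  show "((\<lambda>t. vector [f t, g t, h t]) has_vector_derivative
      X + normal_product i X (vector [f t, g t, h t])) (at t)"
    by (simp only:)
qed

section \<open>Closed-form flows of the normal forms\<close>

lemma affine_action_normal_product_1:
  "affine_action (product_structure (normal_product 1)) (vector [a, b, c]) (vector [x, y, z]) = vector
    [exp a * x + exp a - 1,
     exp a * (exp b - 1) * x + exp (a + b) * y + exp a * (exp b - 1),
     exp a * (exp c - 1) * x + exp (a + c) * z + exp a * (exp c - 1)]"
  \<comment> \<open>\<open>X\<close> has coefficients a, a + b, a + c on the orthogonal idempotents
    e1 - e2 - e3, e2, e3. Exponentiating them, returning to the basis e1, e2, e3 and subtracting the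
    unit e1 gives the three functions.\<close>
  by (subst affine_action_normal_product[where f = "\<lambda>t. exp (t * a) - 1"
        and g = "\<lambda>t. exp (t * a) * (exp (t * b) - 1)"
        and h = "\<lambda>t. exp (t * a) * (exp (t * c) - 1)"])
    (auto intro!: derivative_eq_intros simp: normal_product_simps vec_eq_iff forall_3 exp_add
      field_simps power2_eq_square power3_eq_cube simp del: One_nat_def)

lemma affine_action_normal_product_2:
  "affine_action (product_structure (normal_product 2)) (vector [a, b, c]) (vector [x, y, z]) = vector
    [x * exp a * cos c - z * exp a * sin c + exp a * cos c - 1,
     (exp (a + b) - exp a * cos c) * x + exp (a + b) * y + z * exp a * sin c
     - exp a * cos c + exp (a + b),
     x * exp a * sin c + z * exp a * cos c + exp a * sin c]"
  \<comment> \<open>The C factor is spanned by its unit e1 - e2 and by e3, and contributes the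
    exponential of a + i c; e2 carries the exponent a + b.\<close>
  by (subst affine_action_normal_product[where f = "\<lambda>t. exp (t * a) * cos (t * c) - 1"
        and g = "\<lambda>t. exp (t * a) * exp (t * b) - exp (t * a) * cos (t * c)"
        and h = "\<lambda>t. exp (t * a) * sin (t * c)"])
    (auto intro!: derivative_eq_intros simp: normal_product_simps vec_eq_iff forall_3 exp_add
      field_simps power2_eq_square power3_eq_cube)

lemma affine_action_normal_product_3:
  "affine_action (product_structure (normal_product 3)) (vector [a, b, c]) (vector [x, y, z]) = vector
    [exp a * x + exp a - 1,
     exp a * (exp b - 1) * x + exp (a + b) * y + exp a * (exp b - 1),
     c * exp a * x + exp a * z + c * exp a]"
  by (subst affine_action_normal_product[where f = "\<lambda>t. exp (t * a) - 1"
        and g = "\<lambda>t. exp (t * a) * (exp (t * b) - 1)"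
        and h = "\<lambda>t. t * c * exp (t * a)"])
    (auto intro!: derivative_eq_intros simp: normal_product_simps vec_eq_iff forall_3 exp_add
      field_simps power2_eq_square power3_eq_cube)

lemma affine_action_normal_product_4:
  "affine_action (product_structure (normal_product 4)) (vector [a, b, c]) (vector [x, y, z]) = vector
    [exp a * x + exp a - 1,
     (b + c^2 / 2) * exp a * x + exp a * y + c * exp a * z + (b + c^2 / 2) * exp a,
     c * exp a * x + exp a * z + c * exp a]"
  \<comment> \<open>With e3 as t and e2 as t^2, the exponential of the nilpotent part is 1 + c t +
    (b + c^2/2) t^2.\<close>
  by (subst affine_action_normal_product[where f = "\<lambda>t. exp (t * a) - 1"
        and g = "\<lambda>t. (t * b + (t * c)^2 / 2) * exp (t * a)"
        and h = "\<lambda>t. t * c * exp (t * a)"])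
    (auto intro!: derivative_eq_intros simp: normal_product_simps vec_eq_iff forall_3 exp_add
      field_simps power2_eq_square power3_eq_cube)

lemma affine_action_normal_product_5:
  "affine_action (product_structure (normal_product 5)) (vector [a, b, c]) (vector [x, y, z]) = vector
    [exp a * x + exp a - 1,
     b * exp a * x + exp a * y + b * exp a,
     c * exp a * x + exp a * z + c * exp a]"
  by (subst affine_action_normal_product[where f = "\<lambda>t. exp (t * a) - 1"
        and g = "\<lambda>t. t * b * exp (t * a)"
        and h = "\<lambda>t. t * c * exp (t * a)"])
    (auto intro!: derivative_eq_intros simp: normal_product_simps vec_eq_iff forall_3 exp_add
      field_simps power2_eq_square power3_eq_cube)

lemma affine_action_normal_product_6:
  "affine_action (product_structure (normal_product 6)) (vector [a, b, c]) (vector [x, y, z]) = vector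
    [exp a * x + exp a - 1,
     exp b * y + exp b - 1,
     z + c]"
  by (subst affine_action_normal_product[where f = "\<lambda>t. exp (t * a) - 1"
        and g = "\<lambda>t. exp (t * b) - 1"
        and h = "\<lambda>t. t * c"])
    (auto intro!: derivative_eq_intros simp: normal_product_simps vec_eq_iff forall_3 exp_add
      field_simps power2_eq_square power3_eq_cube)

lemma affine_action_normal_product_7:
  "affine_action (product_structure (normal_product 7)) (vector [a, b, c]) (vector [x, y, z]) = vector
    [x * exp a * cos b - y * exp a * sin b + exp a * cos b - 1,
     x * exp a * sin b + y * exp a * cos b + exp a * sin b,
     z + c]"
  by (subst affine_action_normal_product[where f = "\<lambda>t. exp (t * a) * cos (t * b) - 1"
        and g = "\<lambda>t. exp (t * a) * sin (t * b)"
        and h = "\<lambda>t. t * c"])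
    (auto intro!: derivative_eq_intros simp: normal_product_simps vec_eq_iff forall_3 exp_add
      field_simps power2_eq_square power3_eq_cube)

lemma affine_action_normal_product_8:
  "affine_action (product_structure (normal_product 8)) (vector [a, b, c]) (vector [x, y, z]) = vector
    [exp a * x + exp a - 1,
     y + b,
     z + c]"
  by (subst affine_action_normal_product[where f = "\<lambda>t. exp (t * a) - 1"
        and g = "\<lambda>t. t * b"
        and h = "\<lambda>t. t * c"])
    (auto intro!: derivative_eq_intros simp: normal_product_simps vec_eq_iff forall_3 exp_add
      field_simps power2_eq_square power3_eq_cube)

lemma affine_action_normal_product_9:
  "affine_action (product_structure (normal_product 9)) (vector [a, b, c]) (vector [x, y, z]) = vector
    [exp a * x + exp a - 1,
     b * exp a * x + exp a * y + b * exp a,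
     z + c]"
  by (subst affine_action_normal_product[where f = "\<lambda>t. exp (t * a) - 1"
        and g = "\<lambda>t. t * b * exp (t * a)"
        and h = "\<lambda>t. t * c"])
    (auto intro!: derivative_eq_intros simp: normal_product_simps vec_eq_iff forall_3 exp_add
      field_simps power2_eq_square power3_eq_cube)

lemma affine_action_normal_product_10:
  "affine_action (product_structure (normal_product 10)) (vector [a, b, c]) (vector [x, y, z]) = vector
    [exp a * x + exp a - 1,
     y + b,
     b * y + z + b^2 / 2 + c]"
  by (subst affine_action_normal_product[where f = "\<lambda>t. exp (t * a) - 1"
        and g = "\<lambda>t. t * b"
        and h = "\<lambda>t. (t * b)^2 / 2 + t * c"])
    (auto intro!: derivative_eq_intros simp: normal_product_simps vec_eq_iff forall_3 exp_add
      field_simps power2_eq_square power3_eq_cube)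

lemma affine_action_normal_product_11:
  "affine_action (product_structure (normal_product 11)) (vector [a, b, c]) (vector [x, y, z]) = vector
    [x + a,
     a * x + y + c * z + b + 1 / 2 * (a^2 + c^2),
     z + c]"
  by (subst affine_action_normal_product[where f = "\<lambda>t. t * a"
        and g = "\<lambda>t. t * b + ((t * a)^2 + (t * c)^2) / 2"
        and h = "\<lambda>t. t * c"])
    (auto intro!: derivative_eq_intros simp: normal_product_simps vec_eq_iff forall_3 exp_add
      field_simps power2_eq_square power3_eq_cube)

lemma affine_action_normal_product_12:
  "affine_action (product_structure (normal_product 12)) (vector [a, b, c]) (vector [x, y, z]) = vector
    [x + a,
     a * x + y - c * z + b + 1 / 2 * (a^2 - c^2),
     z + c]"
  by (subst affine_action_normal_product[where f = "\<lambda>t. t * a"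
        and g = "\<lambda>t. t * b + ((t * a)^2 - (t * c)^2) / 2"
        and h = "\<lambda>t. t * c"])
    (auto intro!: derivative_eq_intros simp: normal_product_simps vec_eq_iff forall_3 exp_add
      field_simps power2_eq_square power3_eq_cube)

lemma affine_action_normal_product_13:
  "affine_action (product_structure (normal_product 13)) (vector [a, b, c]) (vector [x, y, z]) = vector
    [x + a,
     a * x + y + b + a^2 / 2,
     z + c]"
  by (subst affine_action_normal_product[where f = "\<lambda>t. t * a"
        and g = "\<lambda>t. t * b + (t * a)^2 / 2"
        and h = "\<lambda>t. t * c"])
    (auto intro!: derivative_eq_intros simp: normal_product_simps vec_eq_iff forall_3 exp_add
      field_simps power2_eq_square power3_eq_cube)

lemma affine_action_normal_product_14:
  "affine_action (product_structure (normal_product 14)) (vector [a, b, c]) (vector [x, y, z]) = vector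
    [x + a,
     a * x + y + b + a^2 / 2,
     (b + a^2 / 2) * x + a * y + z + a^3 / 6 + a * b + c]"
  \<comment> \<open>Here X^4 = 0, so the flow is the polynomial X + X^2/2 + X^3/6 with
    \<open>t\<close> inserted.\<close>
  by (subst affine_action_normal_product[where f = "\<lambda>t. t * a"
        and g = "\<lambda>t. t * b + (t * a)^2 / 2"
        and h = "\<lambda>t. (t * a)^3 / 6 + t * a * (t * b) + t * c"])
    (auto intro!: derivative_eq_intros simp: normal_product_simps vec_eq_iff forall_3 exp_add
      field_simps power2_eq_square power3_eq_cube)

lemma affine_action_normal_product_15:
  "affine_action (product_structure (normal_product 15)) (vector [a, b, c]) (vector [x, y, z]) = vector
    [x + a,
     y + b,
     z + c]"
  by (subst affine_action_normal_product[where f = "\<lambda>t. t * a"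
        and g = "\<lambda>t. t * b"
        and h = "\<lambda>t. t * c"])
    (auto intro!: derivative_eq_intros simp: normal_product_simps vec_eq_iff forall_3 exp_add
      field_simps power2_eq_square power3_eq_cube)

lemmas affine_action_normal_products =
  affine_action_normal_product_1 affine_action_normal_product_2 affine_action_normal_product_3
  affine_action_normal_product_4 affine_action_normal_product_5 affine_action_normal_product_6
  affine_action_normal_product_7 affine_action_normal_product_8 affine_action_normal_product_9
  affine_action_normal_product_10 affine_action_normal_product_11 affine_action_normal_product_12
  affine_action_normal_product_13 affine_action_normal_product_14 affine_action_normal_product_15

text \<open>In 11 to 15 the equation Y + Y X = 0 can be solved coordinate by coordinate and forces Y
  = 0; injectivity suffices in finite dimension. In 1 to 10 the first basis vector is idempotent,
  and X = -e1 destroys injectivity.\<close>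

lemma complete_structure_normal_product:
  assumes "i \<in> {1..15}"
  shows "complete_structure (product_structure (normal_product i)) \<longleftrightarrow> i \<in> {11..15}"
proof -
  interpret commutative_associative "normal_product i"
    using assms by (rule commutative_associative_normal_product)
  let ?f = "\<lambda>X Y. Y + normal_product i Y X"
  have eq: "complete_structure (product_structure (normal_product i)) \<longleftrightarrow> (\<forall>X. bij (?f X))"
    by (simp add: complete_structure_def affine_product_product_structure bilinear)
  show ?thesis
  proof (cases "i \<in> {11..15}")
    case True
    have "bij (?f X)" for X
    proof -
      have lin: "linear (?f X)"
        using bilinear by (simp add: linear_iff bilinear_ladd bilinear_lmul algebra_simps)
      have "Y = 0" if "?f X Y = 0" for Y
        using assms True that
        by (cases rule: le_15_cases) (auto simp: normal_product_simps vec_eq_iff forall_3)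
      then have "inj (?f X)"
        unfolding linear_injective_0[OF lin] by blast
      then show ?thesis
        using linear_injective_imp_surjective[OF lin] by (simp add: bij_def)
    qed
    with True show ?thesis
      by (simp add: eq)
  next
    case False
    define g where "g = ?f (vector [-1, 0, 0])"
    have "normal_product i (vector [1, 0, 0]) (vector [-1, 0, 0]) = - vector [1, 0, 0]"
      using assms
    proof (cases rule: le_15_cases)
      case 1
      show ?thesis by (simp only: 1 normal_product_simps) (simp add: vec_eq_iff forall_3)
    qed (use False in \<open>auto simp: normal_product_simps vec_eq_iff forall_3\<close>)
    then have "g (vector [1, 0, 0]) = g 0"
      using bilinear by (simp add: bilinear_lzero g_def)
    moreover have "vector [1, 0, 0] \<noteq> (0 :: real ^ 3)"
      by (simp add: vec_eq_iff forall_3)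
    ultimately have "\<not> inj g"
      by (metis injD)
    with False show ?thesis
      by (auto simp: eq bij_def g_def)
  qed
qed

subsection \<open>Isomorphism invariants\<close>

definition algebra_isomorphism ::
    "('v::real_vector \<Rightarrow> 'v \<Rightarrow> 'v) \<Rightarrow> ('w::real_vector \<Rightarrow> 'w \<Rightarrow> 'w) \<Rightarrow> ('v \<Rightarrow> 'w) \<Rightarrow> bool"
  where "algebra_isomorphism p q f \<longleftrightarrow> linear f \<and> bij f \<and> (\<forall>x y. f (p x y) = q (f x) (f y))"

definition "has_unit p \<longleftrightarrow> (\<exists>u. \<forall>x. p u x = x)"
definition "has_idempotent p \<longleftrightarrow> (\<exists>e. e \<noteq> 0 \<and> p e e = e)"
definition "has_orthogonal_idempotents p \<longleftrightarrow>
  (\<exists>e f. e \<noteq> 0 \<and> f \<noteq> 0 \<and> p e e = e \<and> p f f = f \<and> p e f = 0)"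
text \<open>In a unital algebra this detects nonzero elements of square zero; in the nil forms it
  detects isotropic vectors outside the radical. Factors with zero product are not seen by
  it.\<close>

definition "has_square_zero_nonannihilator p \<longleftrightarrow> (\<exists>x y. p x x = 0 \<and> p x y \<noteq> 0)"
text \<open>Detects a factor C through 1 and i; in a product of copies of R and lines with zero
  product, two squares cancel only if both vanish.\<close>

definition "has_opposite_squares p \<longleftrightarrow> (\<exists>x y. p x x + p y y = 0 \<and> p x x \<noteq> 0)"
definition "has_nilpotent_of_index_3 p \<longleftrightarrow> (\<exists>x. p x x \<noteq> 0 \<and> p (p x x) x = 0)"
definition "has_nonzero_cube p \<longleftrightarrow> (\<exists>x. p (p x x) x \<noteq> 0)"
definition "has_nonzero_product p \<longleftrightarrow> (\<exists>x y. p x y \<noteq> 0)"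
text \<open>Tells the definite form of rank 2 from the form of rank 1.\<close>

definition "has_orthogonal_nonzero_squares p \<longleftrightarrow> (\<exists>x y. p x x \<noteq> 0 \<and> p y y \<noteq> 0 \<and> p x y = 0)"

text \<open>
  A decision tree of isomorphism invariant properties whose leaf is the index of the normal form.
\<close>

definition kind :: "('v::real_vector \<Rightarrow> 'v \<Rightarrow> 'v) \<Rightarrow> nat" where
  "kind p =
    (if has_unit p then
       (if has_square_zero_nonannihilator p then
          (if has_orthogonal_idempotents p then 3 else if has_nilpotent_of_index_3 p then 4 else 5)
        else if has_opposite_squares p then 2 else 1)
     else if has_idempotent p then
       (if has_nilpotent_of_index_3 p then 10
        else if has_square_zero_nonannihilator p then 9
        else if has_opposite_squares p then 7
        else if has_orthogonal_idempotents p then 6 else 8)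
     else if has_nonzero_cube p then 14
     else if \<not> has_nonzero_product p then 15
     else if has_square_zero_nonannihilator p then 12
     else if has_orthogonal_nonzero_squares p then 11 else 13)"

text \<open>Each property is built from 0, sums, products and equality. Quantifiers over the target
  are pulled back along the surjection \<open>f\<close>, and \<open>f\<close> is then removed by
  injectivity.\<close>

lemma kind_eq_if_isomorphic:
  assumes "algebra_isomorphism p q f"
  shows "kind p = kind q"
proof -
  have lin: "linear f" and "bij f" and hom: "\<And>x y. q (f x) (f y) = f (p x y)"
    using assms by (auto simp: algebra_isomorphism_def)
  have inj: "f x = f y \<longleftrightarrow> x = y" for x y
    using \<open>bij f\<close> by (simp add: bij_is_inj inj_eq)
  have zero: "f x = 0 \<longleftrightarrow> x = 0" for x
    using inj[of x 0] linear_0[OF lin] by simp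
  have ex: "(\<exists>y. P y) \<longleftrightarrow> (\<exists>x. P (f x))" and all: "(\<forall>y. P y) \<longleftrightarrow> (\<forall>x. P (f x))" for P
    using bij_is_surj[OF \<open>bij f\<close>] by (metis surj_def)+
  have add: "f x + f y = f (x + y)" for x y
    by (simp add: linear_add[OF lin])
  have "has_unit q = has_unit p"
    unfolding has_unit_def by (subst ex, subst all) (simp add: hom inj)
  moreover have "has_idempotent q = has_idempotent p"
    unfolding has_idempotent_def by (subst ex) (simp add: hom inj zero)
  moreover have "has_orthogonal_idempotents q = has_orthogonal_idempotents p"
    unfolding has_orthogonal_idempotents_def by (subst (1 2) ex) (simp add: hom inj zero)
  moreover have "has_square_zero_nonannihilator q = has_square_zero_nonannihilator p"
    unfolding has_square_zero_nonannihilator_def by (subst (1 2) ex) (simp add: hom inj zero)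
  moreover have "has_opposite_squares q = has_opposite_squares p"
    unfolding has_opposite_squares_def by (subst (1 2) ex) (simp add: hom inj zero add)
  moreover have "has_nilpotent_of_index_3 q = has_nilpotent_of_index_3 p"
    unfolding has_nilpotent_of_index_3_def by (subst ex) (simp add: hom inj zero)
  moreover have "has_nonzero_cube q = has_nonzero_cube p"
    unfolding has_nonzero_cube_def by (subst ex) (simp add: hom inj zero)
  moreover have "has_nonzero_product q = has_nonzero_product p"
    unfolding has_nonzero_product_def by (subst (1 2) ex) (simp add: hom inj zero)
  moreover have "has_orthogonal_nonzero_squares q = has_orthogonal_nonzero_squares p"
    unfolding has_orthogonal_nonzero_squares_def by (subst (1 2) ex) (simp add: hom inj zero)
  ultimately show ?thesis
    by (simp add: kind_def)
qed

lemma ex_vector_3: "(\<exists>v :: 'a::zero ^ 3. P v) \<longleftrightarrow> (\<exists>a b c. P (vector [a, b, c]))"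
proof -
  have "v = vector [v $ 1, v $ 2, v $ 3]" for v :: "'a ^ 3"
    by (simp add: vec_eq_iff forall_3)
  then show ?thesis
    by metis
qed

section \<open>Evaluation of the invariants on the normal forms\<close>

lemma kind_normal_product_1: "kind (normal_product 1) = 1"
proof -
  let ?p = "normal_product 1"
  have "has_unit ?p"
    unfolding has_unit_def
    by (rule exI[of _ "vector [1, 0, 0]"]) (simp add: normal_product_simps vec_eq_iff forall_3 del: One_nat_def)
  moreover have "\<not> has_square_zero_nonannihilator ?p"
    unfolding has_square_zero_nonannihilator_def ex_vector_3
    by (auto simp: normal_product_simps vec_eq_iff forall_3 algebra_simps simp del: One_nat_def)
  moreover have "\<not> has_opposite_squares ?p"
    unfolding has_opposite_squares_def ex_vector_3
    by (auto simp: normal_product_simps vec_eq_iff forall_3 algebra_simps simp del: One_nat_def)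
  ultimately show ?thesis
    by (simp add: kind_def)
qed

lemma kind_normal_product_2: "kind (normal_product 2) = 2"
proof -
  let ?p = "normal_product 2"
  have "has_unit ?p"
    unfolding has_unit_def
    by (rule exI[of _ "vector [1, 0, 0]"]) (simp add: normal_product_simps vec_eq_iff forall_3)
  moreover have "\<not> has_square_zero_nonannihilator ?p"
    unfolding has_square_zero_nonannihilator_def ex_vector_3
    by (auto simp: normal_product_simps vec_eq_iff forall_3 algebra_simps)
  moreover have "has_opposite_squares ?p"
    unfolding has_opposite_squares_def
    \<comment> \<open>The unit e1 - e2 and the imaginary unit e3 of the factor C.\<close>
    by (rule exI[of _ "vector [1, -1, 0]"], rule exI[of _ "vector [0, 0, 1]"])
      (simp add: normal_product_simps vec_eq_iff forall_3)
  ultimately show ?thesis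
    by (simp add: kind_def)
qed

lemma kind_normal_product_3: "kind (normal_product 3) = 3"
proof -
  let ?p = "normal_product 3"
  have "has_unit ?p"
    unfolding has_unit_def
    by (rule exI[of _ "vector [1, 0, 0]"]) (simp add: normal_product_simps vec_eq_iff forall_3)
  moreover have "has_square_zero_nonannihilator ?p"
    unfolding has_square_zero_nonannihilator_def
    by (rule exI[of _ "vector [0, 0, 1]"], rule exI[of _ "vector [1, 0, 0]"])
      (simp add: normal_product_simps vec_eq_iff forall_3)
  moreover have "has_orthogonal_idempotents ?p"
    unfolding has_orthogonal_idempotents_def
    by (rule exI[of _ "vector [0, 1, 0]"], rule exI[of _ "vector [1, -1, 0]"])
      (simp add: normal_product_simps vec_eq_iff forall_3)
  ultimately show ?thesis
    by (simp add: kind_def)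
qed

lemma kind_normal_product_4: "kind (normal_product 4) = 4"
proof -
  let ?p = "normal_product 4"
  have "has_unit ?p"
    unfolding has_unit_def
    by (rule exI[of _ "vector [1, 0, 0]"]) (simp add: normal_product_simps vec_eq_iff forall_3)
  moreover have "has_square_zero_nonannihilator ?p"
    unfolding has_square_zero_nonannihilator_def
    by (rule exI[of _ "vector [0, 1, 0]"], rule exI[of _ "vector [1, 0, 0]"])
      (simp add: normal_product_simps vec_eq_iff forall_3)
  moreover have "\<not> has_orthogonal_idempotents ?p"
  proof -
    \<comment> \<open>The algebra is local, so its unit is the only nonzero idempotent.\<close>
    have "x = vector [1, 0, 0]" if "?p x x = x" "x \<noteq> 0" for x
      using that by (auto simp: normal_product_simps vec_eq_iff forall_3)
    moreover have "?p (vector [1, 0, 0]) (vector [1, 0, 0]) \<noteq> 0"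
      by (simp add: normal_product_simps vec_eq_iff forall_3)
    ultimately show ?thesis
      unfolding has_orthogonal_idempotents_def by metis
  qed
  moreover have "has_nilpotent_of_index_3 ?p"
    unfolding has_nilpotent_of_index_3_def
    by (rule exI[of _ "vector [0, 0, 1]"]) (simp add: normal_product_simps vec_eq_iff forall_3)
  ultimately show ?thesis
    by (simp add: kind_def)
qed

lemma kind_normal_product_5: "kind (normal_product 5) = 5"
proof -
  let ?p = "normal_product 5"
  have "has_unit ?p"
    unfolding has_unit_def
    by (rule exI[of _ "vector [1, 0, 0]"]) (simp add: normal_product_simps vec_eq_iff forall_3)
  moreover have "has_square_zero_nonannihilator ?p"
    unfolding has_square_zero_nonannihilator_def
    by (rule exI[of _ "vector [0, 1, 0]"], rule exI[of _ "vector [1, 0, 0]"])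
      (simp add: normal_product_simps vec_eq_iff forall_3)
  moreover have "\<not> has_orthogonal_idempotents ?p"
  proof -
    have "x = vector [1, 0, 0]" if "?p x x = x" "x \<noteq> 0" for x
      using that by (auto simp: normal_product_simps vec_eq_iff forall_3)
    moreover have "?p (vector [1, 0, 0]) (vector [1, 0, 0]) \<noteq> 0"
      by (simp add: normal_product_simps vec_eq_iff forall_3)
    ultimately show ?thesis
      unfolding has_orthogonal_idempotents_def by metis
  qed
  moreover have "\<not> has_nilpotent_of_index_3 ?p"
    unfolding has_nilpotent_of_index_3_def ex_vector_3
    by (auto simp: normal_product_simps vec_eq_iff forall_3 algebra_simps)
  ultimately show ?thesis
    by (simp add: kind_def)
qed

lemma kind_normal_product_6: "kind (normal_product 6) = 6"
proof -
  let ?p = "normal_product 6"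
  have "\<not> has_unit ?p"
    unfolding has_unit_def
    \<comment> \<open>The third basis vector annihilates the algebra, so nothing can fix it.\<close>
    by (auto simp: normal_product_simps vec_eq_iff forall_3 intro!: exI[of _ "vector [0, 0, 1]"])
  moreover have "has_idempotent ?p"
    unfolding has_idempotent_def
    by (rule exI[of _ "vector [1, 0, 0]"]) (simp add: normal_product_simps vec_eq_iff forall_3)
  moreover have "\<not> has_nilpotent_of_index_3 ?p"
    unfolding has_nilpotent_of_index_3_def ex_vector_3
    by (auto simp: normal_product_simps vec_eq_iff forall_3 algebra_simps)
  moreover have "\<not> has_square_zero_nonannihilator ?p"
    unfolding has_square_zero_nonannihilator_def ex_vector_3
    by (auto simp: normal_product_simps vec_eq_iff forall_3 algebra_simps)
  moreover have "\<not> has_opposite_squares ?p"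
    unfolding has_opposite_squares_def ex_vector_3
    by (auto simp: normal_product_simps vec_eq_iff forall_3 algebra_simps)
  moreover have "has_orthogonal_idempotents ?p"
    unfolding has_orthogonal_idempotents_def
    by (rule exI[of _ "vector [1, 0, 0]"], rule exI[of _ "vector [0, 1, 0]"])
      (simp add: normal_product_simps vec_eq_iff forall_3)
  ultimately show ?thesis
    by (simp add: kind_def)
qed

lemma kind_normal_product_7: "kind (normal_product 7) = 7"
proof -
  let ?p = "normal_product 7"
  have "\<not> has_unit ?p"
    unfolding has_unit_def
    by (auto simp: normal_product_simps vec_eq_iff forall_3 intro!: exI[of _ "vector [0, 0, 1]"])
  moreover have "has_idempotent ?p"
    unfolding has_idempotent_def
    by (rule exI[of _ "vector [1, 0, 0]"]) (simp add: normal_product_simps vec_eq_iff forall_3)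
  moreover have "\<not> has_nilpotent_of_index_3 ?p"
  proof -
    \<comment> \<open>These equations say that the cube of a + b i vanishes, after cancelling
      \<open>a\<close> from its real and \<open>b\<close> from its imaginary part.\<close>
    have "b = 0" if "a * (a * 3) = b * b" "a * a = b * (b * 3)" for a b :: real
    proof -
      have "b * b = 0" using that by algebra
      then show ?thesis by simp
    qed
    then show ?thesis
      unfolding has_nilpotent_of_index_3_def ex_vector_3
      by (auto simp: normal_product_simps vec_eq_iff forall_3 algebra_simps)
  qed
  moreover have "\<not> has_square_zero_nonannihilator ?p"
    unfolding has_square_zero_nonannihilator_def ex_vector_3
    by (auto simp: normal_product_simps vec_eq_iff forall_3 algebra_simps)
  moreover have "has_opposite_squares ?p"
    unfolding has_opposite_squares_def
    by (rule exI[of _ "vector [1, 0, 0]"], rule exI[of _ "vector [0, 1, 0]"])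
      (simp add: normal_product_simps vec_eq_iff forall_3)
  ultimately show ?thesis
    by (simp add: kind_def)
qed

lemma kind_normal_product_8: "kind (normal_product 8) = 8"
proof -
  let ?p = "normal_product 8"
  have "\<not> has_unit ?p"
    unfolding has_unit_def
    by (auto simp: normal_product_simps vec_eq_iff forall_3 intro!: exI[of _ "vector [0, 0, 1]"])
  moreover have "has_idempotent ?p"
    unfolding has_idempotent_def
    by (rule exI[of _ "vector [1, 0, 0]"]) (simp add: normal_product_simps vec_eq_iff forall_3)
  moreover have "\<not> has_nilpotent_of_index_3 ?p"
    unfolding has_nilpotent_of_index_3_def ex_vector_3
    by (auto simp: normal_product_simps vec_eq_iff forall_3 algebra_simps)
  moreover have "\<not> has_square_zero_nonannihilator ?p"
    unfolding has_square_zero_nonannihilator_def ex_vector_3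
    by (auto simp: normal_product_simps vec_eq_iff forall_3 algebra_simps)
  moreover have "\<not> has_opposite_squares ?p"
    unfolding has_opposite_squares_def ex_vector_3
    by (auto simp: normal_product_simps vec_eq_iff forall_3 algebra_simps)
  moreover have "\<not> has_orthogonal_idempotents ?p"
  proof -
    have "x = vector [1, 0, 0]" if "?p x x = x" "x \<noteq> 0" for x
      using that by (auto simp: normal_product_simps vec_eq_iff forall_3)
    moreover have "?p (vector [1, 0, 0]) (vector [1, 0, 0]) \<noteq> 0"
      by (simp add: normal_product_simps vec_eq_iff forall_3)
    ultimately show ?thesis
      unfolding has_orthogonal_idempotents_def by metis
  qed
  ultimately show ?thesis
    by (simp add: kind_def)
qed

lemma kind_normal_product_9: "kind (normal_product 9) = 9"
proof -
  let ?p = "normal_product 9"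
  have "\<not> has_unit ?p"
    unfolding has_unit_def
    by (auto simp: normal_product_simps vec_eq_iff forall_3 intro!: exI[of _ "vector [0, 0, 1]"])
  moreover have "has_idempotent ?p"
    unfolding has_idempotent_def
    by (rule exI[of _ "vector [1, 0, 0]"]) (simp add: normal_product_simps vec_eq_iff forall_3)
  moreover have "\<not> has_nilpotent_of_index_3 ?p"
    unfolding has_nilpotent_of_index_3_def ex_vector_3
    by (auto simp: normal_product_simps vec_eq_iff forall_3 algebra_simps)
  moreover have "has_square_zero_nonannihilator ?p"
    unfolding has_square_zero_nonannihilator_def
    by (rule exI[of _ "vector [0, 1, 0]"], rule exI[of _ "vector [1, 0, 0]"])
      (simp add: normal_product_simps vec_eq_iff forall_3)
  ultimately show ?thesis
    by (simp add: kind_def)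
qed

lemma kind_normal_product_10: "kind (normal_product 10) = 10"
proof -
  let ?p = "normal_product 10"
  have "\<not> has_unit ?p"
    unfolding has_unit_def
    by (auto simp: normal_product_simps vec_eq_iff forall_3 intro!: exI[of _ "vector [0, 0, 1]"])
  moreover have "has_idempotent ?p"
    unfolding has_idempotent_def
    by (rule exI[of _ "vector [1, 0, 0]"]) (simp add: normal_product_simps vec_eq_iff forall_3)
  moreover have "has_nilpotent_of_index_3 ?p"
    unfolding has_nilpotent_of_index_3_def
    by (rule exI[of _ "vector [0, 1, 0]"]) (simp add: normal_product_simps vec_eq_iff forall_3)
  ultimately show ?thesis
    by (simp add: kind_def)
qed

lemma kind_normal_product_11: "kind (normal_product 11) = 11"
proof -
  let ?p = "normal_product 11"
  have "\<not> has_unit ?p"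
    unfolding has_unit_def
    by (auto simp: normal_product_simps vec_eq_iff forall_3 intro!: exI[of _ "vector [1, 0, 0]"])
  moreover have "\<not> has_idempotent ?p"
    unfolding has_idempotent_def ex_vector_3
    by (auto simp: normal_product_simps vec_eq_iff forall_3 algebra_simps)
  moreover have "\<not> has_nonzero_cube ?p"
    unfolding has_nonzero_cube_def ex_vector_3
    by (auto simp: normal_product_simps vec_eq_iff forall_3 algebra_simps)
  moreover have "has_nonzero_product ?p"
    unfolding has_nonzero_product_def
    by (rule exI[of _ "vector [1, 0, 0]"], rule exI[of _ "vector [1, 0, 0]"])
      (simp add: normal_product_simps vec_eq_iff forall_3)
  moreover have "\<not> has_square_zero_nonannihilator ?p"
    unfolding has_square_zero_nonannihilator_def ex_vector_3
    by (auto simp: normal_product_simps vec_eq_iff forall_3 algebra_simps)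
  moreover have "has_orthogonal_nonzero_squares ?p"
    unfolding has_orthogonal_nonzero_squares_def
    by (rule exI[of _ "vector [1, 0, 0]"], rule exI[of _ "vector [0, 0, 1]"])
      (simp add: normal_product_simps vec_eq_iff forall_3)
  ultimately show ?thesis
    by (simp add: kind_def)
qed

lemma kind_normal_product_12: "kind (normal_product 12) = 12"
proof -
  let ?p = "normal_product 12"
  have "\<not> has_unit ?p"
    unfolding has_unit_def
    by (auto simp: normal_product_simps vec_eq_iff forall_3 intro!: exI[of _ "vector [1, 0, 0]"])
  moreover have "\<not> has_idempotent ?p"
    unfolding has_idempotent_def ex_vector_3
    by (auto simp: normal_product_simps vec_eq_iff forall_3 algebra_simps)
  moreover have "\<not> has_nonzero_cube ?p"
    unfolding has_nonzero_cube_def ex_vector_3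
    by (auto simp: normal_product_simps vec_eq_iff forall_3 algebra_simps)
  moreover have "has_nonzero_product ?p"
    unfolding has_nonzero_product_def
    by (rule exI[of _ "vector [1, 0, 0]"], rule exI[of _ "vector [1, 0, 0]"])
      (simp add: normal_product_simps vec_eq_iff forall_3)
  moreover have "has_square_zero_nonannihilator ?p"
    unfolding has_square_zero_nonannihilator_def
    \<comment> \<open>An isotropic vector of the form a^2 - c^2.\<close>
    by (rule exI[of _ "vector [1, 0, 1]"], rule exI[of _ "vector [1, 0, 0]"])
      (simp add: normal_product_simps vec_eq_iff forall_3)
  ultimately show ?thesis
    by (simp add: kind_def)
qed

lemma kind_normal_product_13: "kind (normal_product 13) = 13"
proof -
  let ?p = "normal_product 13"
  have "\<not> has_unit ?p"
    unfolding has_unit_def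
    by (auto simp: normal_product_simps vec_eq_iff forall_3 intro!: exI[of _ "vector [1, 0, 0]"])
  moreover have "\<not> has_idempotent ?p"
    unfolding has_idempotent_def ex_vector_3
    by (auto simp: normal_product_simps vec_eq_iff forall_3 algebra_simps)
  moreover have "\<not> has_nonzero_cube ?p"
    unfolding has_nonzero_cube_def ex_vector_3
    by (auto simp: normal_product_simps vec_eq_iff forall_3 algebra_simps)
  moreover have "has_nonzero_product ?p"
    unfolding has_nonzero_product_def
    by (rule exI[of _ "vector [1, 0, 0]"], rule exI[of _ "vector [1, 0, 0]"])
      (simp add: normal_product_simps vec_eq_iff forall_3)
  moreover have "\<not> has_square_zero_nonannihilator ?p"
    unfolding has_square_zero_nonannihilator_def ex_vector_3
    by (auto simp: normal_product_simps vec_eq_iff forall_3 algebra_simps)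
  moreover have "\<not> has_orthogonal_nonzero_squares ?p"
    unfolding has_orthogonal_nonzero_squares_def ex_vector_3
    by (auto simp: normal_product_simps vec_eq_iff forall_3 algebra_simps)
  ultimately show ?thesis
    by (simp add: kind_def)
qed

lemma kind_normal_product_14: "kind (normal_product 14) = 14"
proof -
  let ?p = "normal_product 14"
  have "\<not> has_unit ?p"
    unfolding has_unit_def
    by (auto simp: normal_product_simps vec_eq_iff forall_3 intro!: exI[of _ "vector [1, 0, 0]"])
  moreover have "\<not> has_idempotent ?p"
    unfolding has_idempotent_def ex_vector_3
    by (auto simp: normal_product_simps vec_eq_iff forall_3 algebra_simps)
  moreover have "has_nonzero_cube ?p"
    unfolding has_nonzero_cube_def
    by (rule exI[of _ "vector [1, 0, 0]"]) (simp add: normal_product_simps vec_eq_iff forall_3)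
  ultimately show ?thesis
    by (simp add: kind_def)
qed

lemma kind_normal_product_15: "kind (normal_product 15) = 15"
proof -
  let ?p = "normal_product 15"
  have "\<not> has_unit ?p"
    unfolding has_unit_def
    by (auto simp: normal_product_simps vec_eq_iff forall_3 intro!: exI[of _ "vector [1, 0, 0]"])
  moreover have "\<not> has_idempotent ?p"
    unfolding has_idempotent_def ex_vector_3
    by (auto simp: normal_product_simps vec_eq_iff forall_3 algebra_simps)
  moreover have "\<not> has_nonzero_cube ?p"
    unfolding has_nonzero_cube_def ex_vector_3
    by (auto simp: normal_product_simps vec_eq_iff forall_3 algebra_simps)
  moreover have "\<not> has_nonzero_product ?p"
    unfolding has_nonzero_product_def ex_vector_3
    by (auto simp: normal_product_simps vec_eq_iff forall_3 algebra_simps)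
  ultimately show ?thesis
    by (simp add: kind_def)
qed

lemma kind_normal_product:
  assumes "i \<in> {1..15}"
  shows "kind (normal_product i) = i"
  using assms
  by (cases rule: le_15_cases)
    (simp_all only: kind_normal_product_1 kind_normal_product_2 kind_normal_product_3 kind_normal_product_4
      kind_normal_product_5 kind_normal_product_6 kind_normal_product_7 kind_normal_product_8
      kind_normal_product_9 kind_normal_product_10 kind_normal_product_11 kind_normal_product_12
      kind_normal_product_13 kind_normal_product_14 kind_normal_product_15)

subsection \<open>Bases of three-dimensional space\<close>

text \<open>Stated by coefficients rather than for the set {u, v}: a set hides repeated vectors, and
  relations are exploited below by multiplying them with algebra elements.\<close>

definition indep2 :: "'v::real_vector \<Rightarrow> 'v \<Rightarrow> bool"
  where "indep2 u v \<longleftrightarrow> (\<forall>a b. a *\<^sub>R u + b *\<^sub>R v = 0 \<longrightarrow> a = 0 \<and> b = 0)"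

definition indep3 :: "'v::real_vector \<Rightarrow> 'v \<Rightarrow> 'v \<Rightarrow> bool"
  where "indep3 u v w \<longleftrightarrow>
    (\<forall>a b c. a *\<^sub>R u + b *\<^sub>R v + c *\<^sub>R w = 0 \<longrightarrow> a = 0 \<and> b = 0 \<and> c = 0)"

lemma indep2I:
  fixes v :: "'v::real_vector"
  assumes "u \<noteq> 0" "v \<notin> span {u}"
  shows "indep2 u v"
  unfolding indep2_def
proof (intro allI impI)
  fix a b :: real assume ab: "a *\<^sub>R u + b *\<^sub>R v = 0"
  have "b = 0"
  proof (rule ccontr)
    assume "b \<noteq> 0"
    have "b *\<^sub>R v = - (a *\<^sub>R u)" using ab by (simp add: eq_neg_iff_add_eq_0 add.commute)
    also have "\<dots> \<in> span {u}" by (simp add: span_neg span_scale span_base)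
    finally have "b *\<^sub>R v \<in> span {u}" .
    from span_scale[OF this, of "1 / b"] have "v \<in> span {u}" using \<open>b \<noteq> 0\<close> by simp
    with assms show False by simp
  qed
  with ab assms show "a = 0 \<and> b = 0" by simp
qed

lemma indep3I:
  fixes w :: "'v::real_vector"
  assumes "indep2 u v" "w \<notin> span {u, v}"
  shows "indep3 u v w"
  unfolding indep3_def
proof (intro allI impI)
  fix a b c :: real assume abc: "a *\<^sub>R u + b *\<^sub>R v + c *\<^sub>R w = 0"
  have "c = 0"
  proof (rule ccontr)
    assume "c \<noteq> 0"
    have "c *\<^sub>R w = - (a *\<^sub>R u + b *\<^sub>R v)" using abc by (metis add.commute eq_neg_iff_add_eq_0)
    also have "\<dots> \<in> span {u, v}" by (intro span_neg span_add span_scale span_base) auto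
    finally have "c *\<^sub>R w \<in> span {u, v}" .
    from span_scale[OF this, of "1 / c"] have "w \<in> span {u, v}" using \<open>c \<noteq> 0\<close> by simp
    with assms show False by simp
  qed
  with abc assms show "a = 0 \<and> b = 0 \<and> c = 0" by (simp add: indep2_def)
qed

lemma indep2_in_dim_2:
  fixes S :: "'v::euclidean_space set"
  assumes "subspace S" "dim S = 2" "u \<in> S" "u \<noteq> 0"
  obtains v where "v \<in> S" "indep2 u v"
proof -
  have "dim (span {u}) \<le> card {u}" by (intro dim_le_card) auto
  with assms(2) have "\<not> S \<subseteq> span {u}"
    using dim_subset[of S "span {u}"] by auto
  then obtain v where "v \<in> S" "v \<notin> span {u}" by blast
  with assms(4) show thesis
    by (intro that[of v] indep2I)
qed

lemma indep2_spans_dim_2: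
  fixes S :: "'v::euclidean_space set"
  assumes "subspace S" "dim S = 2" "u \<in> S" "v \<in> S" "indep2 u v" "z \<in> S"
  obtains a b where "z = a *\<^sub>R u + b *\<^sub>R v"
proof (cases "z \<in> span {u, v}")
  case True
  then show thesis
    using that by (auto simp: span_insert span_singleton algebra_simps)
next
  case False
  have ind: "indep3 u v z" using indep3I[OF assms(5) False] .
  have "u \<noteq> 0" using assms(5)[unfolded indep2_def, rule_format, of 1 0] by auto
  have "v \<notin> span {u}"
  proof
    assume "v \<in> span {u}"
    then obtain k where "v = k *\<^sub>R u" by (auto simp: span_singleton)
    then show False using assms(5)[unfolded indep2_def, rule_format, of k "-1"] by simp
  qed
  then have "dim {u, v} = 2"
    using \<open>u \<noteq> 0\<close> by (simp add: insert_commute[of u] dim_insert)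
  then have "dim {z, u, v} = 3"
    using False by (simp add: dim_insert)
  moreover have "dim {z, u, v} \<le> dim S"
    by (rule dim_subset) (use assms in auto)
  ultimately show thesis using assms(2) by simp
qed

lemma extend_indep2:
  fixes u v :: "real ^ 3"
  assumes "indep2 u v"
  obtains w where "indep3 u v w"
proof -
  have "dim {u, v} \<le> card {u, v}" by (intro dim_le_card') auto
  also have "\<dots> \<le> 2" by (simp add: card_insert_if)
  finally have "dim (span {u, v}) < dim (UNIV :: (real ^ 3) set)" by (simp add: dim_UNIV)
  then obtain w where "w \<notin> span {u, v}" by (metis UNIV_eq_I less_irrefl)
  with assms show thesis by (intro that[of w] indep3I)
qed

definition combination3 :: "'v::real_vector \<Rightarrow> 'v \<Rightarrow> 'v \<Rightarrow> real ^ 3 \<Rightarrow> 'v"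
  where "combination3 u v w X = X $ 1 *\<^sub>R u + X $ 2 *\<^sub>R v + X $ 3 *\<^sub>R w"

lemma linear_combination3: "linear (combination3 u v w)"
  by (simp add: linear_iff combination3_def algebra_simps)

lemma bij_combination3:
  fixes u v w :: "real ^ 3"
  assumes "indep3 u v w"
  shows "bij (combination3 u v w)"
proof -
  have "X = 0" if "combination3 u v w X = 0" for X
  proof -
    have "X $ 1 = 0 \<and> X $ 2 = 0 \<and> X $ 3 = 0"
      using assms that unfolding combination3_def indep3_def by blast
    then show ?thesis by (simp add: vec_eq_iff forall_3)
  qed
  then have "inj (combination3 u v w)"
    unfolding linear_injective_0[OF linear_combination3] by blast
  then show ?thesis
    using linear_injective_imp_surjective[OF linear_combination3[of u v w]] by (simp add: bij_def)
qed

lemma indep3_spans: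
  fixes u v w :: "real ^ 3"
  assumes "indep3 u v w"
  obtains a b c where "z = a *\<^sub>R u + b *\<^sub>R v + c *\<^sub>R w"
  using bij_is_surj[OF bij_combination3[OF assms]] by (metis surjE combination3_def)

text \<open>Obtained from the kernel of a linear map out of \<open>real ^ 4\<close>, so that the
  four vectors, later powers of one element, may coincide.\<close>

lemma four_dependent:
  fixes x y z w :: "real ^ 3"
  obtains a b c d where "a *\<^sub>R x + b *\<^sub>R y + c *\<^sub>R z + d *\<^sub>R w = 0" "\<not> (a = 0 \<and> b = 0 \<and> c = 0 \<and> d = 0)"
proof -
  define g :: "real ^ 4 \<Rightarrow> real ^ 3"
    where "g X = X $ 1 *\<^sub>R x + X $ 2 *\<^sub>R y + X $ 3 *\<^sub>R z + X $ 4 *\<^sub>R w" for X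
  have lin: "linear g"
    by (simp add: linear_iff g_def algebra_simps)
  have "\<not> inj g"
  proof
    assume "inj g"
    then have "dim (range g) = dim (UNIV :: (real ^ 4) set)"
      by (intro dim_image_eq lin) auto
    moreover have "dim (range g) \<le> DIM(real ^ 3)"
      by (rule dim_subset_UNIV)
    ultimately show False by (simp add: dim_UNIV)
  qed
  then obtain X where "g X = 0" "X \<noteq> 0"
    unfolding linear_injective_0[OF lin] by blast
  then show thesis
    using that[of "X $ 1" "X $ 2" "X $ 3" "X $ 4"] by (auto simp: g_def vec_eq_iff forall_4)
qed

subsection \<open>Idempotents and nilpotents\<close>

context commutative_associative
begin

lemma left_commute: "x \<cdot> (y \<cdot> z) = y \<cdot> (x \<cdot> z)"
  by (metis assoc commute)

lemmas ac = assoc commute left_commute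

lemma add_left: "(x + y) \<cdot> z = x \<cdot> z + y \<cdot> z"
  and add_right: "x \<cdot> (y + z) = x \<cdot> y + x \<cdot> z"
  and diff_left: "(x - y) \<cdot> z = x \<cdot> z - y \<cdot> z"
  and diff_right: "x \<cdot> (y - z) = x \<cdot> y - x \<cdot> z"
  and scaleR_left: "(c *\<^sub>R x) \<cdot> y = c *\<^sub>R (x \<cdot> y)"
  and scaleR_right: "x \<cdot> (c *\<^sub>R y) = c *\<^sub>R (x \<cdot> y)"
  and zero_left [simp]: "0 \<cdot> x = 0"
  and zero_right [simp]: "x \<cdot> 0 = 0"
  and minus_left: "(- x) \<cdot> y = - (x \<cdot> y)"
  and minus_right: "x \<cdot> (- y) = - (x \<cdot> y)"
  using bilinear
  by (simp_all add: bilinear_ladd bilinear_radd bilinear_lsub bilinear_rsub bilinear_lmul bilinear_rmul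
      bilinear_lzero bilinear_rzero bilinear_lneg bilinear_rneg)

lemmas expand = add_left add_right diff_left diff_right scaleR_left scaleR_right minus_left minus_right

lemma eigenspace_subspace: "subspace {x. e \<cdot> x = x}" "subspace {x. e \<cdot> x = 0}"
  by (auto simp: subspace_def expand)

lemma polarization:
  assumes "\<And>x. x \<in> S \<Longrightarrow> x \<cdot> x = 0" "subspace S" "x \<in> S" "y \<in> S"
  shows "x \<cdot> y = 0"
proof -
  have "(x + y) \<cdot> (x + y) = 0"
    using assms by (simp add: subspace_add)
  then have "2 *\<^sub>R (x \<cdot> y) = 0"
    using assms by (simp add: expand commute[of y x] scaleR_2)
  then show ?thesis by simp
qed

text \<open>In dimension 3 every nilpotent element has fourth power 0, so one fixed exponent
  expresses nilpotency.\<close>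

abbreviation nil4 :: "'v \<Rightarrow> bool"
  where "nil4 x \<equiv> x \<cdot> (x \<cdot> (x \<cdot> x)) = 0"

lemma nil4_mult: "nil4 x \<Longrightarrow> nil4 (x \<cdot> y)"
proof -
  assume "nil4 x"
  have "(x \<cdot> y) \<cdot> ((x \<cdot> y) \<cdot> ((x \<cdot> y) \<cdot> (x \<cdot> y))) =
      (x \<cdot> (x \<cdot> (x \<cdot> x))) \<cdot> (y \<cdot> (y \<cdot> (y \<cdot> y)))"
    by (simp only: ac)
  then show ?thesis using \<open>nil4 x\<close> by simp
qed

lemma nil4_scaleR: "nil4 x \<Longrightarrow> nil4 (c *\<^sub>R x)"
  by (simp add: expand)

text \<open>Multiplying \<open>v\<close> four times by \<open>x\<close> gives c^4 v on the one hand
  and 0 on the other.\<close>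

lemma nil4_eigenvector:
  assumes "nil4 x" "x \<cdot> v = c *\<^sub>R v" "v \<noteq> 0"
  shows "c = 0"
proof -
  have "x \<cdot> (x \<cdot> (x \<cdot> (x \<cdot> v))) = (x \<cdot> (x \<cdot> (x \<cdot> x))) \<cdot> v"
    by (simp only: ac)
  then have "x \<cdot> (x \<cdot> (x \<cdot> (x \<cdot> v))) = 0" using assms(1) by simp
  then show ?thesis using assms(2,3) by (simp add: scaleR_right)
qed

end

section \<open>Structure of three-dimensional algebras\<close>

locale algebra3 = commutative_associative p
  for p :: "real ^ 3 \<Rightarrow> real ^ 3 \<Rightarrow> real ^ 3" (infixl "\<cdot>" 70)
begin

definition normalizable :: bool
  where "normalizable \<longleftrightarrow> (\<exists>i\<in>{1..15}. \<exists>f. algebra_isomorphism (normal_product i) p f)"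

text \<open>By bilinearity and commutativity, six products of basis vectors determine the whole
  multiplication; the isomorphism sends coordinates to combinations of \<open>u\<close>,
  \<open>v\<close>, \<open>w\<close>.\<close>

lemma normalizableI:
  assumes i: "i \<in> {1..15}" and ind: "indep3 u v w"
    and "u \<cdot> u = combination3 u v w (normal_product i (vector [1, 0, 0]) (vector [1, 0, 0]))"
    and "u \<cdot> v = combination3 u v w (normal_product i (vector [1, 0, 0]) (vector [0, 1, 0]))"
    and "u \<cdot> w = combination3 u v w (normal_product i (vector [1, 0, 0]) (vector [0, 0, 1]))"
    and "v \<cdot> v = combination3 u v w (normal_product i (vector [0, 1, 0]) (vector [0, 1, 0]))"
    and "v \<cdot> w = combination3 u v w (normal_product i (vector [0, 1, 0]) (vector [0, 0, 1]))"
    and "w \<cdot> w = combination3 u v w (normal_product i (vector [0, 0, 1]) (vector [0, 0, 1]))"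
  shows normalizable
proof -
  let ?f = "combination3 u v w"
  interpret q: commutative_associative "normal_product i"
    using i by (rule commutative_associative_normal_product)
  have e: "X = X $ 1 *\<^sub>R vector [1, 0, 0] + X $ 2 *\<^sub>R vector [0, 1, 0] + X $ 3 *\<^sub>R vector [0, 0, 1]"
    for X :: "real ^ 3"
    by (simp add: vec_eq_iff forall_3)
  have f: "?f (X + Y) = ?f X + ?f Y" "?f (c *\<^sub>R X) = c *\<^sub>R ?f X" for X Y c
    using linear_combination3[of u v w] by (simp_all add: linear_iff)
  have "?f (normal_product i X Y) = ?f X \<cdot> ?f Y" for X Y
  proof -
    have "?f X \<cdot> ?f Y = (X $ 1 * Y $ 1) *\<^sub>R (u \<cdot> u) + (X $ 1 * Y $ 2 + X $ 2 * Y $ 1) *\<^sub>R (u \<cdot> v)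
        + (X $ 1 * Y $ 3 + X $ 3 * Y $ 1) *\<^sub>R (u \<cdot> w) + (X $ 2 * Y $ 2) *\<^sub>R (v \<cdot> v)
        + (X $ 2 * Y $ 3 + X $ 3 * Y $ 2) *\<^sub>R (v \<cdot> w) + (X $ 3 * Y $ 3) *\<^sub>R (w \<cdot> w)"
      by (simp add: combination3_def expand commute[of v u] commute[of w u] commute[of w v] algebra_simps)
    moreover have "normal_product i X Y =
        (X $ 1 * Y $ 1) *\<^sub>R normal_product i (vector [1, 0, 0]) (vector [1, 0, 0])
        + (X $ 1 * Y $ 2 + X $ 2 * Y $ 1) *\<^sub>R normal_product i (vector [1, 0, 0]) (vector [0, 1, 0])
        + (X $ 1 * Y $ 3 + X $ 3 * Y $ 1) *\<^sub>R normal_product i (vector [1, 0, 0]) (vector [0, 0, 1])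
        + (X $ 2 * Y $ 2) *\<^sub>R normal_product i (vector [0, 1, 0]) (vector [0, 1, 0])
        + (X $ 2 * Y $ 3 + X $ 3 * Y $ 2) *\<^sub>R normal_product i (vector [0, 1, 0]) (vector [0, 0, 1])
        + (X $ 3 * Y $ 3) *\<^sub>R normal_product i (vector [0, 0, 1]) (vector [0, 0, 1])"
      by (subst e[of X], subst e[of Y])
        (simp add: q.expand q.commute[of "vector [0, 1, 0]" "vector [1, 0, 0]"]
          q.commute[of "vector [0, 0, 1]" "vector [1, 0, 0]"]
          q.commute[of "vector [0, 0, 1]" "vector [0, 1, 0]"] algebra_simps)
    ultimately show ?thesis
      using assms(3-) by (simp only: f)
  qed
  then have "algebra_isomorphism (normal_product i) p ?f"
    by (simp add: algebra_isomorphism_def linear_combination3 bij_combination3[OF ind])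
  with i show ?thesis
    unfolding normalizable_def by blast
qed

text \<open>The idempotent is delivered as a multiple of \<open>x\<close>: it then lies in every
  ideal containing \<open>x\<close>, and if it equals a unit then \<open>x\<close> is
  invertible.\<close>

lemma nil4_or_idempotent:
  obtains "nil4 x" | z where "(x \<cdot> z) \<cdot> (x \<cdot> z) = x \<cdot> z" "x \<cdot> z \<noteq> 0"
proof -
  let ?x2 = "x \<cdot> x" and ?x3 = "x \<cdot> (x \<cdot> x)" and ?x4 = "x \<cdot> (x \<cdot> (x \<cdot> x))"
  \<comment> \<open>Dividing the relation by its lowest term gives \<open>x^3 = x^3 s\<close> with \<open>s\<close> a polynomial in \<open>x\<close>.\<close>
  obtain a b c d where eq: "a *\<^sub>R x + b *\<^sub>R ?x2 + c *\<^sub>R ?x3 + d *\<^sub>R ?x4 = 0"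
    and nz: "\<not> (a = 0 \<and> b = 0 \<and> c = 0 \<and> d = 0)"
    by (rule four_dependent)
  show thesis
  proof (cases "nil4 x")
    case False
    have "\<exists>\<alpha> \<beta> \<gamma>. ?x3 \<cdot> (\<alpha> *\<^sub>R x + \<beta> *\<^sub>R ?x2 + \<gamma> *\<^sub>R ?x3) = ?x3"
    proof -
      \<comment> \<open>If only \<open>d\<close> were nonzero, the relation would say that the
        fourth power of \<open>x\<close> is 0.\<close>
      consider "a \<noteq> 0" | "a = 0" "b \<noteq> 0" | "a = 0" "b = 0" "c \<noteq> 0"
        using nz eq False by force
      then show ?thesis
      proof cases
        case 1
        let ?s = "(- b / a) *\<^sub>R x + (- c / a) *\<^sub>R ?x2 + (- d / a) *\<^sub>R ?x3"
        have "a *\<^sub>R (x \<cdot> ?s) = - (b *\<^sub>R ?x2 + c *\<^sub>R ?x3 + d *\<^sub>R ?x4)"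
          using 1 by (simp add: expand algebra_simps)
        also have "\<dots> = a *\<^sub>R x"
          using eq by (simp add: algebra_simps add_eq_0_iff2)
        finally have "x \<cdot> ?s = x" using 1 by simp
        then have "(x \<cdot> x) \<cdot> (x \<cdot> ?s) = (x \<cdot> x) \<cdot> x" by simp
        then have "?x3 \<cdot> ?s = ?x3" by (simp only: ac)
        then show ?thesis by blast
      next
        case 2
        let ?s = "(- c / b) *\<^sub>R x + (- d / b) *\<^sub>R ?x2 + 0 *\<^sub>R ?x3"
        have "b *\<^sub>R (?x2 \<cdot> ?s) = - (c *\<^sub>R ?x3 + d *\<^sub>R ?x4)"
          using 2 by (simp add: expand ac algebra_simps)
        also have "\<dots> = b *\<^sub>R ?x2"
          using eq 2 by (simp add: algebra_simps add_eq_0_iff2)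
        finally have "?x2 \<cdot> ?s = ?x2" using 2 by simp
        then have "x \<cdot> (?x2 \<cdot> ?s) = x \<cdot> ?x2" by simp
        then have "?x3 \<cdot> ?s = ?x3" by (simp only: ac)
        then show ?thesis by blast
      next
        case 3
        let ?s = "(- d / c) *\<^sub>R x + 0 *\<^sub>R ?x2 + 0 *\<^sub>R ?x3"
        have "c *\<^sub>R (?x3 \<cdot> ?s) = - (d *\<^sub>R ?x4)"
          using 3 by (simp add: expand ac algebra_simps)
        also have "\<dots> = c *\<^sub>R ?x3"
          using eq 3 by (simp add: algebra_simps add_eq_0_iff2)
        finally have "?x3 \<cdot> ?s = ?x3" using 3 by simp
        then show ?thesis by blast
      qed
    qed
    then obtain \<alpha> \<beta> \<gamma> where "?x3 \<cdot> (\<alpha> *\<^sub>R x + \<beta> *\<^sub>R ?x2 + \<gamma> *\<^sub>R ?x3) = ?x3"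
      by blast
    moreover define s where "s = \<alpha> *\<^sub>R x + \<beta> *\<^sub>R ?x2 + \<gamma> *\<^sub>R ?x3"
    ultimately have x3: "?x3 \<cdot> s = ?x3" by simp
    \<comment> \<open>\<open>s\<close> is the identity on \<open>x^3 A\<close>, and \<open>s^3\<close> acts as it does but is itself fixed by \<open>s\<close>.\<close>
    define M where "M = {y. y \<cdot> s = y}"
    have add_M: "y + y' \<in> M" if "y \<in> M" "y' \<in> M" for y y'
      using that by (simp add: M_def expand)
    have scale_M: "r *\<^sub>R y \<in> M" if "y \<in> M" for r y
      using that by (simp add: M_def expand)
    have mult_M: "z \<cdot> y \<in> M" if "y \<in> M" for y z
      using that by (simp add: M_def assoc)
    have s_eq:
      "y \<cdot> s = \<alpha> *\<^sub>R (y \<cdot> x) + \<beta> *\<^sub>R ((y \<cdot> x) \<cdot> x) + \<gamma> *\<^sub>R (((y \<cdot> x) \<cdot> x) \<cdot> x)" for y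
      by (simp add: s_def expand assoc)
    have s_M: "y \<cdot> s \<in> M" if "y \<cdot> x \<in> M" for y
    proof -
      have 1: "(y \<cdot> x) \<cdot> x \<in> M" using mult_M[OF that, of x] by (simp only: commute)
      have 2: "((y \<cdot> x) \<cdot> x) \<cdot> x \<in> M" using mult_M[OF 1, of x] by (simp only: commute)
      show ?thesis unfolding s_eq by (intro add_M scale_M that 1 2)
    qed
    have "?x3 \<in> M" using x3 by (simp add: M_def)
    \<comment> \<open>The three factors \<open>x\<close> of \<open>?x3\<close> are exchanged for
      \<open>s\<close> one at a time by \<open>s_M\<close>.\<close>
    then have "(x \<cdot> x) \<cdot> s \<in> M" by (intro s_M) (simp only: ac)
    then have "(s \<cdot> x) \<cdot> x \<in> M" by (simp only: ac)
    then have "(s \<cdot> x) \<cdot> s \<in> M" by (rule s_M)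
    then have "(s \<cdot> s) \<cdot> x \<in> M" by (simp only: ac)
    then have "(s \<cdot> s) \<cdot> s \<in> M" by (rule s_M)
    moreover define e where "e = (s \<cdot> s) \<cdot> s"
    ultimately have es: "e \<cdot> s = e" by (simp add: M_def)
    have "e \<cdot> e = ((e \<cdot> s) \<cdot> s) \<cdot> s" by (simp only: e_def ac)
    then have ee: "e \<cdot> e = e" by (simp only: es)
    have x3e: "?x3 \<cdot> e = ((?x3 \<cdot> s) \<cdot> s) \<cdot> s" by (simp only: e_def ac)
    then have "?x3 \<cdot> e = ?x3" by (simp only: x3)
    with False have "e \<noteq> 0" by auto
    moreover have "e = x \<cdot> (\<alpha> *\<^sub>R e + \<beta> *\<^sub>R (x \<cdot> e) + \<gamma> *\<^sub>R (x \<cdot> (x \<cdot> e)))"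
      using es s_eq[of e] by (simp add: expand ac)
    ultimately show thesis
      using ee that(2)[of "\<alpha> *\<^sub>R e + \<beta> *\<^sub>R (x \<cdot> e) + \<gamma> *\<^sub>R (x \<cdot> (x \<cdot> e))"] by metis
  qed (rule that(1))
qed

text \<open>Without a unit, the splitting is z = e z + (z - e z).\<close>

lemma peirce_dim:
  assumes "e \<cdot> e = e"
  shows "dim {x. e \<cdot> x = x} + dim {x. e \<cdot> x = 0} = 3"
proof -
  have "{x + y |x y. x \<in> {x. e \<cdot> x = x} \<and> y \<in> {x. e \<cdot> x = 0}} = UNIV"
  proof (intro UNIV_eq_I[symmetric] CollectI)
    fix z
    have "e \<cdot> (e \<cdot> z) = e \<cdot> z" using assms by (simp flip: assoc)
    then have "z = e \<cdot> z + (z - e \<cdot> z) \<and> e \<cdot> z \<in> {x. e \<cdot> x = x} \<and> z - e \<cdot> z \<in> {x. e \<cdot> x = 0}"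
      by (simp add: expand)
    then show "\<exists>x y. z = x + y \<and> x \<in> {x. e \<cdot> x = x} \<and> y \<in> {x. e \<cdot> x = 0}"
      by blast
  qed
  moreover have "{x. e \<cdot> x = x} \<inter> {x. e \<cdot> x = 0} = {0}"
    by auto
  ultimately show ?thesis
    using dim_sums_Int[OF eigenspace_subspace, of e e] by (simp add: dim_UNIV)
qed

text \<open>An idempotent of greatest rank works: a nonzero orthogonal \<open>f\<close> could be
  added to it, and \<open>e + f\<close> fixes everything that \<open>e\<close> fixes and also
  \<open>f\<close>.\<close>

lemma obtain_maximal_idempotent:
  obtains e where "e \<cdot> e = e" "\<And>f. f \<cdot> f = f \<Longrightarrow> e \<cdot> f = 0 \<Longrightarrow> f = 0"
proof -
  let ?P = "\<lambda>e. e \<cdot> e = e" and ?d = "\<lambda>e. dim {x. e \<cdot> x = x}"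
  have "?P 0" by simp
  moreover have "\<forall>e. ?P e \<longrightarrow> ?d e < 4"
    using dim_subset_UNIV[where 'a = "real ^ 3"] by (simp add: less_Suc_eq_le eval_nat_numeral)
  ultimately obtain e where e: "e \<cdot> e = e" and max: "\<And>f. f \<cdot> f = f \<Longrightarrow> ?d f \<le> ?d e"
    using ex_has_greatest_nat[of ?P 0 ?d 4] by blast
  have "f = 0" if f: "f \<cdot> f = f" "e \<cdot> f = 0" for f
  proof (rule ccontr)
    assume "f \<noteq> 0"
    let ?S = "{x. e \<cdot> x = x}"
    have "f \<notin> span ?S"
      using \<open>f \<noteq> 0\<close> f(2) by (simp add: span_eq_iff[THEN iffD2, OF eigenspace_subspace(1)])
    then have "dim (insert f ?S) = ?d e + 1" by (simp add: dim_insert)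
    moreover have "insert f ?S \<subseteq> {x. (e + f) \<cdot> x = x}"
    proof -
      have "f \<cdot> x = 0" if "e \<cdot> x = x" for x
        by (metis assoc commute f(2) that zero_left)
      then show ?thesis using f by (auto simp: expand)
    qed
    then have "dim (insert f ?S) \<le> ?d (e + f)" by (rule dim_subset)
    moreover have "(e + f) \<cdot> (e + f) = e + f"
      using e f by (simp add: expand commute[of f e])
    ultimately show False using max[of "e + f"] by simp
  qed
  with e show thesis by (rule that)
qed

text \<open>If all squares vanish, polarization kills all products. Otherwise some \<open>x\<close>
  and its nonzero square form a basis, and nilpotency forces the cube of \<open>x\<close> to be
  0.\<close>

lemma nil_dim_2_basis:
  assumes S: "subspace S" "dim S = 2" and closed: "\<And>x y. x \<in> S \<Longrightarrow> y \<in> S \<Longrightarrow> x \<cdot> y \<in> S"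
    and nil: "\<And>x. x \<in> S \<Longrightarrow> nil4 x"
  obtains u v where "u \<in> S" "v \<in> S" "indep2 u v" "u \<cdot> v = 0" "v \<cdot> v = 0" "u \<cdot> u = v \<or> u \<cdot> u = 0"
proof (cases "\<forall>x\<in>S. x \<cdot> x = 0")
  case True
  obtain u where u: "u \<in> S" "u \<noteq> 0"
    using S(2) dim_eq_0[of S] by auto
  obtain v where v: "v \<in> S" "indep2 u v"
    using indep2_in_dim_2[OF S u] .
  have "u \<cdot> v = 0"
    using polarization[OF _ S(1) u(1) v(1)] True by blast
  then show thesis
    using that[OF u(1) v] True u v by simp
next
  case False
  then obtain x where x: "x \<in> S" "x \<cdot> x \<noteq> 0" by blast
  have n: "nil4 x" using nil x by blast
  have ind: "indep2 x (x \<cdot> x)"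
    unfolding indep2_def
  proof (intro allI impI)
    fix a b assume ab: "a *\<^sub>R x + b *\<^sub>R (x \<cdot> x) = 0"
    have 1: "a *\<^sub>R (x \<cdot> x) + b *\<^sub>R (x \<cdot> (x \<cdot> x)) = 0"
      using arg_cong[OF ab, of "\<lambda>y. x \<cdot> y"] by (simp add: expand)
    have "a *\<^sub>R (x \<cdot> (x \<cdot> x)) = 0"
      using arg_cong[OF 1, of "\<lambda>y. x \<cdot> y"] n by (simp add: expand)
    then have "a = 0" using 1 x(2) by auto
    then show "a = 0 \<and> b = 0" using ab x(2) by simp
  qed
  obtain a b where ab: "x \<cdot> (x \<cdot> x) = a *\<^sub>R x + b *\<^sub>R (x \<cdot> x)"
    using indep2_spans_dim_2[OF S x(1) closed[OF x(1) x(1)] ind closed[OF x(1) closed[OF x(1) x(1)]]] .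
  \<comment> \<open>Repeated multiplication by \<open>x\<close>: whichever of \<open>a\<close>,
    \<open>b\<close> is the first nonzero coefficient, the cube of \<open>x\<close> vanishes, and it
    does so too if both are 0.\<close>
  have 1: "a *\<^sub>R (x \<cdot> x) + b *\<^sub>R (x \<cdot> (x \<cdot> x)) = 0"
    using arg_cong[OF ab, of "\<lambda>y. x \<cdot> y"] n by (simp add: expand)
  have 2: "a *\<^sub>R (x \<cdot> (x \<cdot> x)) = 0"
    using arg_cong[OF 1, of "\<lambda>y. x \<cdot> y"] n by (simp add: expand)
  have "x \<cdot> (x \<cdot> x) = 0"
    using ab 1 2 by auto
  moreover have "(x \<cdot> x) \<cdot> (x \<cdot> x) = 0"
    using n by (simp only: ac)
  ultimately show thesis
    using that[OF x(1) closed[OF x(1) x(1)] ind] by simp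
qed

text \<open>Completing the square in the quadratic equation of \<open>y\<close> over
  \<open>e\<close>. The values -1, 0, 1 of \<open>c\<close> correspond to C, the dual numbers and R
  x R.\<close>

lemma unital_dim_2_basis:
  assumes e: "e \<cdot> e = e" and dim: "dim {x. e \<cdot> x = x} = 2"
  obtains x c where "e \<cdot> x = x" "x \<cdot> x = c *\<^sub>R e" "c \<in> {-1, 0, 1}" "indep2 e x"
proof -
  let ?S = "{x. e \<cdot> x = x}"
  have "e \<noteq> 0"
  proof
    assume "e = 0"
    then have "?S = {0}" by auto
    with dim show False by simp
  qed
  then obtain y where y: "y \<in> ?S" "indep2 e y"
    using indep2_in_dim_2[OF eigenspace_subspace(1) dim, of e] e by auto
  have yy: "y \<cdot> y \<in> ?S" using y(1) by (simp flip: assoc)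
  obtain a b where ab: "y \<cdot> y = a *\<^sub>R e + b *\<^sub>R y"
    using indep2_spans_dim_2[OF eigenspace_subspace(1) dim _ y yy] e by auto
  define x0 where "x0 = y - (b / 2) *\<^sub>R e"
  define \<delta> where "\<delta> = a + b\<^sup>2 / 4"
  have x0: "x0 \<cdot> x0 = \<delta> *\<^sub>R e" "e \<cdot> x0 = x0"
    using y(1) e ab by (simp_all add: x0_def \<delta>_def expand commute[of y e] algebra_simps power2_eq_square
        flip: scaleR_add_left)
  \<comment> \<open>Scaling by \<open>k\<close> multiplies the square by k^2, so only the sign of
    \<delta> remains; for \<delta> = 0 any nonzero \<open>k\<close> will do.\<close>
  define k where "k = (if \<delta> = 0 then 1 else 1 / sqrt \<bar>\<delta>\<bar>)"
  have "k \<noteq> 0" "k * k * \<delta> = sgn \<delta>"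
    by (auto simp: k_def sgn_if abs_if)
  have "indep2 e (k *\<^sub>R x0)"
    unfolding indep2_def
  proof (intro allI impI)
    fix s t assume "s *\<^sub>R e + t *\<^sub>R k *\<^sub>R x0 = 0"
    then have "(s - t * k * b / 2) *\<^sub>R e + (t * k) *\<^sub>R y = 0"
      by (simp add: x0_def algebra_simps)
    then have "s - t * k * b / 2 = 0 \<and> t * k = 0"
      using y(2) unfolding indep2_def by blast
    then show "s = 0 \<and> t = 0" using \<open>k \<noteq> 0\<close> by auto
  qed
  moreover have "(k *\<^sub>R x0) \<cdot> (k *\<^sub>R x0) = sgn \<delta> *\<^sub>R e"
    using \<open>k * k * \<delta> = sgn \<delta>\<close> by (simp add: expand x0 mult.assoc)
  moreover have "sgn \<delta> \<in> {-1, 0, 1}" by (simp add: sgn_if)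
  ultimately show thesis
    using that[of "k *\<^sub>R x0" "sgn \<delta>"] x0(2) by (simp add: expand)
qed

subsection \<open>Reduction to normal form\<close>

lemmas table = normal_product_simps combination3_def

text \<open>A nonzero cube yields the basis x, x^2, x^3 of form 14. If all cubes vanish but some
  square does not, the product is a quadratic form with values in the line of y = x^2; diagonalizing
  it gives 11, 12 or 13.\<close>

lemma normalizable_nil:
  assumes nil: "\<And>x. nil4 x"
  shows normalizable
proof (cases "\<forall>x. x \<cdot> (x \<cdot> x) = 0")
  case False
  then obtain x where x: "x \<cdot> (x \<cdot> x) \<noteq> 0" by blast
  have ind: "indep3 x (x \<cdot> x) (x \<cdot> (x \<cdot> x))"
    unfolding indep3_def
  proof (intro allI impI)
    fix a b c assume abc: "a *\<^sub>R x + b *\<^sub>R (x \<cdot> x) + c *\<^sub>R (x \<cdot> (x \<cdot> x)) = 0"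
    have 1: "a *\<^sub>R (x \<cdot> x) + b *\<^sub>R (x \<cdot> (x \<cdot> x)) = 0"
      using arg_cong[OF abc, of "\<lambda>y. x \<cdot> y"] nil by (simp add: expand)
    have "a *\<^sub>R (x \<cdot> (x \<cdot> x)) = 0"
      using arg_cong[OF 1, of "\<lambda>y. x \<cdot> y"] nil by (simp add: expand)
    then show "a = 0 \<and> b = 0 \<and> c = 0"
      using x abc 1 by auto
  qed
  have "(x \<cdot> x) \<cdot> (x \<cdot> x) = 0" "(x \<cdot> x) \<cdot> (x \<cdot> (x \<cdot> x)) = 0"
    "(x \<cdot> (x \<cdot> x)) \<cdot> (x \<cdot> (x \<cdot> x)) = 0"
    using nil[of x] by (simp_all add: assoc)
  then show ?thesis
    by (intro normalizableI[OF _ ind, of 14]) (simp_all add: table nil)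
next
  case cube: True
  show ?thesis
  proof (cases "\<forall>x. x \<cdot> x = 0")
    case True
    then have zero: "x \<cdot> y = 0" for x y
      using polarization[of UNIV x y] by simp
    have "indep3 (vector [1, 0, 0] :: real ^ 3) (vector [0, 1, 0]) (vector [0, 0, 1])"
      by (simp add: indep3_def vec_eq_iff forall_3)
    then show ?thesis
      by (intro normalizableI[of 15]) (simp_all add: table zero)
  next
    case False
    then obtain x where x: "x \<cdot> x \<noteq> 0" by blast
    \<comment> \<open>Linearization of the identity x^3 = 0, comparing x + y with x - y.\<close>
    have xxy: "x \<cdot> (x \<cdot> y) = 0" for x y
    proof -
      have "(x + y) \<cdot> ((x + y) \<cdot> (x + y)) =
          x \<cdot> (x \<cdot> x) + y \<cdot> (y \<cdot> y) + 3 *\<^sub>R (x \<cdot> (x \<cdot> y)) + 3 *\<^sub>R (x \<cdot> (y \<cdot> y))"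
        "(x - y) \<cdot> ((x - y) \<cdot> (x - y)) =
          x \<cdot> (x \<cdot> x) - y \<cdot> (y \<cdot> y) - 3 *\<^sub>R (x \<cdot> (x \<cdot> y)) + 3 *\<^sub>R (x \<cdot> (y \<cdot> y))"
        by (simp_all only: expand ac) (simp_all add: vec_eq_iff)
      then have "3 *\<^sub>R (x \<cdot> (x \<cdot> y)) + 3 *\<^sub>R (x \<cdot> (y \<cdot> y)) = 0"
        "3 *\<^sub>R (x \<cdot> (y \<cdot> y)) - 3 *\<^sub>R (x \<cdot> (x \<cdot> y)) = 0"
        using cube by simp_all
      then show ?thesis by (simp add: vec_eq_iff)
    qed
    define y where "y = x \<cdot> x"
    have y: "x \<cdot> y = 0" "y \<cdot> y = 0" "y \<cdot> z = 0" for z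
      using cube xxy by (simp_all add: y_def assoc)
    have "indep2 x y"
      unfolding indep2_def
    proof (intro allI impI)
      fix a b assume ab: "a *\<^sub>R x + b *\<^sub>R y = 0"
      have "a *\<^sub>R y = 0"
        using arg_cong[OF ab, of "\<lambda>z. x \<cdot> z"] by (simp add: expand y flip: y_def)
      then show "a = 0 \<and> b = 0" using ab x by (simp add: y_def)
    qed
    then obtain z0 where z0: "indep3 x y z0" by (rule extend_indep2)
    obtain a b c where abc: "x \<cdot> z0 = a *\<^sub>R x + b *\<^sub>R y + c *\<^sub>R z0"
      using indep3_spans[OF z0] .
    \<comment> \<open>Multiplication by \<open>x\<close> kills the left side of \<open>abc\<close>;
      substituting \<open>abc\<close> again yields a relation in the basis with coefficient c^2 on
      \<open>z0\<close>.\<close>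
    have "a *\<^sub>R y + c *\<^sub>R (x \<cdot> z0) = 0"
      using arg_cong[OF abc, of "\<lambda>z. x \<cdot> z"] xxy by (simp add: expand y flip: y_def)
    then have "(c * a) *\<^sub>R x + (a + c * b) *\<^sub>R y + (c * c) *\<^sub>R z0 = 0"
      by (simp add: abc algebra_simps)
    then have "c * a = 0 \<and> a + c * b = 0 \<and> c * c = 0"
      using z0 unfolding indep3_def by blast
    then have "c = 0" "a = 0" by auto
    \<comment> \<open>Only x z0 = b y remains, so subtracting b x makes the new vector orthogonal to
      \<open>x\<close>.\<close>
    define z where "z = z0 - b *\<^sub>R x"
    have xz: "x \<cdot> z = 0"
      using abc \<open>c = 0\<close> \<open>a = 0\<close> by (simp add: z_def expand flip: y_def)
    have z: "indep3 x y z"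
      unfolding indep3_def
    proof (intro allI impI)
      fix r s t assume "r *\<^sub>R x + s *\<^sub>R y + t *\<^sub>R z = 0"
      then have "(r - t * b) *\<^sub>R x + s *\<^sub>R y + t *\<^sub>R z0 = 0"
        by (simp add: z_def algebra_simps)
      then have "r - t * b = 0 \<and> s = 0 \<and> t = 0"
        using z0 unfolding indep3_def by blast
      then show "r = 0 \<and> s = 0 \<and> t = 0" by simp
    qed
    obtain a' \<delta> c' where zz: "z \<cdot> z = a' *\<^sub>R x + \<delta> *\<^sub>R y + c' *\<^sub>R z"
      using indep3_spans[OF z] .
    have "x \<noteq> 0" "y \<noteq> 0" using x by (auto simp: y_def)
    have "a' *\<^sub>R y = x \<cdot> (z \<cdot> z)"
      by (simp add: zz expand y xz flip: y_def)
    then have "a' = 0"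
      using \<open>y \<noteq> 0\<close> xxy[of z x] by (simp add: ac)
    \<comment> \<open>The cube of \<open>z\<close> is c' times its square; a nonzero
      \<open>c'\<close> would make that square nonzero.\<close>
    have "c' *\<^sub>R (z \<cdot> z) = z \<cdot> (z \<cdot> z)"
      by (subst (2) zz) (simp add: \<open>a' = 0\<close> expand commute[of z y] y)
    then have "c' *\<^sub>R (z \<cdot> z) = 0" using cube by simp
    then have "c' = 0"
    proof (rule contrapos_pp)
      assume "c' \<noteq> 0"
      then show "c' *\<^sub>R (z \<cdot> z) \<noteq> 0"
        using zz z[unfolded indep3_def, rule_format, of a' \<delta> c'] by auto
    qed
    have zz: "z \<cdot> z = \<delta> *\<^sub>R y" using zz \<open>a' = 0\<close> \<open>c' = 0\<close> by simp
    show ?thesis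
    proof (cases "\<delta> = 0")
      case True
      then show ?thesis
        by (intro normalizableI[OF _ z, of 13]) (simp_all add: table y xz zz flip: y_def)
    next
      case False
      define k where "k = 1 / sqrt \<bar>\<delta>\<bar>"
      have k: "k \<noteq> 0" "k * k * \<delta> = sgn \<delta>" using False by (auto simp: k_def sgn_if abs_if)
      have kz: "indep3 x y (k *\<^sub>R z)"
        unfolding indep3_def
      proof (intro allI impI)
        fix r s t assume "r *\<^sub>R x + s *\<^sub>R y + t *\<^sub>R k *\<^sub>R z = 0"
        then have "r *\<^sub>R x + s *\<^sub>R y + (t * k) *\<^sub>R z = 0" by simp
        then have "r = 0 \<and> s = 0 \<and> t * k = 0"
          using z unfolding indep3_def by blast
        then show "r = 0 \<and> s = 0 \<and> t = 0" using k by simp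
      qed
      have kk: "(k *\<^sub>R z) \<cdot> (k *\<^sub>R z) = sgn \<delta> *\<^sub>R y"
        using k by (simp add: expand zz mult.assoc)
      have 0: "x \<cdot> (k *\<^sub>R z) = 0" "y \<cdot> (k *\<^sub>R z) = 0"
        by (simp_all add: expand xz y)
      show ?thesis
      proof (cases "\<delta> > 0")
        case True
        then show ?thesis
          by (intro normalizableI[OF _ kz, of 11]) (simp_all add: table y 0 kk flip: y_def)
      next
        case neg: False
        then show ?thesis using False
          by (intro normalizableI[OF _ kz, of 12]) (simp_all add: table y 0 kk flip: y_def)
      qed
    qed
  qed
qed

end

lemma cubic_has_root:
  fixes a b c :: real
  obtains t where "t^3 + a * t^2 + b * t + c = 0"
proof -
  \<comment> \<open>A Cauchy-type root bound: K >= 1 and the expansion of K * K^2 make the cubic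
    term dominate at K and at -K.\<close>
  define K where "K = 1 + \<bar>a\<bar> + \<bar>b\<bar> + \<bar>c\<bar>"
  have "K \<ge> 1" by (simp add: K_def)
  then have "1 \<le> K^2" by (rule one_le_power)
  have "K \<le> K^2" using \<open>K \<ge> 1\<close> by (simp add: power2_eq_square mult_le_cancel_left1)
  then have "\<bar>b\<bar> * K \<le> \<bar>b\<bar> * K^2" by (simp add: mult_left_mono)
  moreover have "\<bar>c\<bar> * 1 \<le> \<bar>c\<bar> * K^2"
    using \<open>1 \<le> K^2\<close> by (intro mult_left_mono) simp_all
  moreover have "K^3 = K^2 + \<bar>a\<bar> * K^2 + \<bar>b\<bar> * K^2 + \<bar>c\<bar> * K^2"
    by (subst power3_eq_cube, subst (3) K_def) (simp add: algebra_simps power2_eq_square)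
  moreover have "\<bar>a * K^2\<bar> = \<bar>a\<bar> * K^2" "\<bar>b * K\<bar> = \<bar>b\<bar> * K"
    using \<open>K \<ge> 1\<close> by (simp_all add: abs_mult)
  ultimately have "K^3 + a * K^2 + b * K + c \<ge> 0" "- (K^3) + a * K^2 - b * K + c \<le> 0"
    using \<open>1 \<le> K^2\<close> abs_ge_self[of "a * K^2"] abs_ge_minus_self[of "a * K^2"]
      abs_ge_self[of "b * K"] abs_ge_minus_self[of "b * K"] abs_ge_self[of c] abs_ge_minus_self[of c]
    by linarith+
  moreover have "continuous_on {-K..K} (\<lambda>t. t^3 + a * t^2 + b * t + c)"
    by (intro continuous_intros)
  ultimately show thesis
    using IVT'[of "\<lambda>t. t^3 + a * t^2 + b * t + c" "-K" 0 K] \<open>K \<ge> 1\<close> that by auto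
qed

text \<open>The dimension is odd: the characteristic polynomial is a real cubic and has a
  root.\<close>

lemma linear_real_3_has_eigenvector:
  fixes f :: "real ^ 3 \<Rightarrow> real ^ 3"
  assumes "linear f"
  obtains c v where "v \<noteq> 0" "f v = c *\<^sub>R v"
proof -
  define M where "M = matrix f"
  have "\<exists>a b d. \<forall>t. det (M - mat t) = - (t^3 + a * t^2 + b * t + d)"
    \<comment> \<open>Up to sign: trace, sum of the principal 2 x 2 minors, determinant.\<close>
    by (rule exI[of _ "- (M $ 1 $ 1 + M $ 2 $ 2 + M $ 3 $ 3)"],
        rule exI[of _ "M $ 1 $ 1 * M $ 2 $ 2 + M $ 1 $ 1 * M $ 3 $ 3 + M $ 2 $ 2 * M $ 3 $ 3
          - M $ 1 $ 2 * M $ 2 $ 1 - M $ 1 $ 3 * M $ 3 $ 1 - M $ 2 $ 3 * M $ 3 $ 2"],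
        rule exI[of _ "- det M"])
      (simp add: det_3 mat_def algebra_simps power2_eq_square power3_eq_cube)
  then obtain t where "det (M - mat t) = 0"
    by (metis cubic_has_root neg_equal_0_iff_equal)
  then have "\<not> inj ((*v) (M - mat t))"
    by (metis invertible_det_nz invertible_left_inverse matrix_left_invertible_injective)
  then obtain v where v: "(M - mat t) *v v = 0" "v \<noteq> 0"
    unfolding linear_injective_0[OF matrix_vector_mul_linear] by blast
  have "mat t *v v = t *\<^sub>R v"
    by (simp add: vec_eq_iff matrix_vector_mult_def mat_def if_distrib if_distribR cong: if_cong)
  then have "f v = t *\<^sub>R v"
    using v(1) assms by (simp add: M_def matrix_vector_mult_diff_rdistrib matrix_works)
  with v(2) show thesis by (rule that)
qed

section \<open>Algebras with a nonzero idempotent, by its rank\<close>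

context algebra3
begin

lemma normalizable_rank_1:
  assumes e: "e \<cdot> e = e" and max: "\<And>f. f \<cdot> f = f \<Longrightarrow> e \<cdot> f = 0 \<Longrightarrow> f = 0"
    and dim: "dim {x. e \<cdot> x = x} = 1"
  shows normalizable
proof -
  let ?S = "{x. e \<cdot> x = 0}"
  have "e \<noteq> 0"
  proof
    assume "e = 0"
    then have "{x. e \<cdot> x = x} = {0}" by auto
    with dim show False by simp
  qed
  have S: "dim ?S = 2" using peirce_dim[OF e] dim by simp
  \<comment> \<open>An idempotent multiple of \<open>x\<close> stays in the ideal annihilated by
    \<open>e\<close>, where \<open>max\<close> admits only 0.\<close>
  have nil: "nil4 x" if "x \<in> ?S" for x
  proof (rule nil4_or_idempotent[of x])
    fix z assume z: "(x \<cdot> z) \<cdot> (x \<cdot> z) = x \<cdot> z" "x \<cdot> z \<noteq> 0"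
    have "e \<cdot> (x \<cdot> z) = 0" using that by (simp flip: assoc)
    with max z show ?thesis by blast
  qed
  have closed: "x \<cdot> y \<in> ?S" if "x \<in> ?S" "y \<in> ?S" for x y
    using that by (simp flip: assoc)
  obtain u v where S': "u \<in> ?S" "v \<in> ?S" and uv: "indep2 u v" "u \<cdot> v = 0" "v \<cdot> v = 0"
    "u \<cdot> u = v \<or> u \<cdot> u = 0"
    by (rule nil_dim_2_basis[OF eigenspace_subspace(2) S closed nil])
  have eu: "e \<cdot> u = 0" "e \<cdot> v = 0" using S' by simp_all
  have ind: "indep3 e u v"
    unfolding indep3_def
  proof (intro allI impI)
    fix a b c assume abc: "a *\<^sub>R e + b *\<^sub>R u + c *\<^sub>R v = 0"
    have "a *\<^sub>R e = 0"
      using arg_cong[OF abc, of "\<lambda>z. e \<cdot> z"] by (simp add: expand e eu)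
    then show "a = 0 \<and> b = 0 \<and> c = 0"
      using abc \<open>e \<noteq> 0\<close> uv(1) by (simp add: indep2_def)
  qed
  from uv(4) show ?thesis
  proof
    assume "u \<cdot> u = v"
    then show ?thesis
      by (intro normalizableI[OF _ ind, of 10]) (simp_all add: table e eu uv)
  next
    assume "u \<cdot> u = 0"
    then show ?thesis
      by (intro normalizableI[OF _ ind, of 8]) (simp_all add: table e eu uv)
  qed
qed

text \<open>The part fixed by \<open>e\<close> is C, the dual numbers or R x R; the complement is a
  line which maximality of \<open>e\<close> forces to have zero product.\<close>

lemma normalizable_rank_2:
  assumes e: "e \<cdot> e = e" and max: "\<And>f. f \<cdot> f = f \<Longrightarrow> e \<cdot> f = 0 \<Longrightarrow> f = 0"
    and dim: "dim {x. e \<cdot> x = x} = 2"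
  shows normalizable
proof -
  obtain x c where x: "e \<cdot> x = x" "x \<cdot> x = c *\<^sub>R e" "c \<in> {-1, 0, 1}" "indep2 e x"
    using unital_dim_2_basis[OF e dim] .
  have "{x. e \<cdot> x = x} \<noteq> UNIV"
    using dim by (auto simp: dim_UNIV)
  then obtain y where "e \<cdot> y \<noteq> y" by auto
  define n where "n = y - e \<cdot> y"
  have n: "n \<noteq> 0" "e \<cdot> n = 0"
    using \<open>e \<cdot> y \<noteq> y\<close> by (simp_all add: n_def expand e flip: assoc)
  have xn: "x \<cdot> n = 0"
    by (metis x(1) n(2) assoc commute zero_left)
  have ind: "indep3 e x n"
    unfolding indep3_def
  proof (intro allI impI)
    fix a b d assume abd: "a *\<^sub>R e + b *\<^sub>R x + d *\<^sub>R n = 0"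
    have "a *\<^sub>R e + b *\<^sub>R x = 0"
      using arg_cong[OF abd, of "\<lambda>z. e \<cdot> z"] by (simp add: expand e x n)
    then have "a = 0 \<and> b = 0" using x(4) by (simp add: indep2_def)
    then show "a = 0 \<and> b = 0 \<and> d = 0" using abd n by simp
  qed
  obtain a b d where abd: "n \<cdot> n = a *\<^sub>R e + b *\<^sub>R x + d *\<^sub>R n"
    using indep3_spans[OF ind] .
  \<comment> \<open>Multiplying by \<open>e\<close> isolates the components of the square of
    \<open>n\<close> along \<open>e\<close> and \<open>x\<close>, which therefore vanish.\<close>
  have "e \<cdot> (n \<cdot> n) = 0" using n(2) by (simp flip: assoc)
  then have "a *\<^sub>R e + b *\<^sub>R x = 0"
    unfolding abd by (simp add: expand e x n)
  then have nn: "n \<cdot> n = d *\<^sub>R n" using abd by simp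
  have "nil4 n"
  proof (rule nil4_or_idempotent[of n])
    fix z assume z: "(n \<cdot> z) \<cdot> (n \<cdot> z) = n \<cdot> z" "n \<cdot> z \<noteq> 0"
    have "e \<cdot> (n \<cdot> z) = 0" using n(2) by (simp flip: assoc)
    with max z show ?thesis by blast
  qed
  then have "d = 0" using nn n(1) by (rule nil4_eigenvector)
  with nn have nn: "n \<cdot> n = 0" by simp
  from x(3) consider "c = -1" | "c = 0" | "c = 1" by auto
  then show ?thesis
  proof cases
    case 1
    then show ?thesis
      by (intro normalizableI[OF _ ind, of 7]) (simp_all add: table e x n xn nn)
  next
    case 2
    then show ?thesis
      by (intro normalizableI[OF _ ind, of 9]) (simp_all add: table e x n xn nn)
  next
    case 3
    \<comment> \<open>Since x^2 = e, the elements (e + x)/2 and (e - x)/2 are orthogonal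
      idempotents.\<close>
    define f where "f = (1 / 2) *\<^sub>R (e + x)"
    define g where "g = (1 / 2) *\<^sub>R (e - x)"
    have fg: "f \<cdot> f = f" "g \<cdot> g = g" "f \<cdot> g = 0" "f \<cdot> n = 0" "g \<cdot> n = 0"
      using 3 by (simp_all add: f_def g_def expand e x n xn commute[of x e] vec_eq_iff field_simps)
    have ind: "indep3 f g n"
      unfolding indep3_def
    proof (intro allI impI)
      fix r s t assume "r *\<^sub>R f + s *\<^sub>R g + t *\<^sub>R n = 0"
      then have "((r + s) / 2) *\<^sub>R e + ((r - s) / 2) *\<^sub>R x + t *\<^sub>R n = 0"
        by (simp add: f_def g_def vec_eq_iff field_simps)
      then have "(r + s) / 2 = 0 \<and> (r - s) / 2 = 0 \<and> t = 0"
        using ind unfolding indep3_def by blast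
      then show "r = 0 \<and> s = 0 \<and> t = 0" by auto
    qed
    show ?thesis
      by (intro normalizableI[OF _ ind, of 6]) (simp_all add: table fg nn)
  qed
qed

text \<open>The annihilator of \<open>f\<close> is a two-dimensional algebra with unit e - f, so the
  whole is R times C, the dual numbers or R x R. The bases start with \<open>e\<close> because the
  normal forms 1 to 3 use the global unit.\<close>

lemma normalizable_unital_split:
  assumes unit: "\<And>x. e \<cdot> x = x" and f: "f \<cdot> f = f" "f \<noteq> 0"
    and dim: "dim {x. f \<cdot> x = 0} = 2"
  shows normalizable
proof -
  define g where "g = e - f"
  have fe: "f \<cdot> e = f" using unit[of f] by (simp only: commute)
  have g: "g \<cdot> g = g" "f \<cdot> g = 0" "g \<cdot> f = 0"
    by (simp_all add: g_def expand unit fe f)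
  have "{x. g \<cdot> x = x} = {x. f \<cdot> x = 0}"
    by (auto simp: g_def expand unit)
  then have "dim {x. g \<cdot> x = x} = 2" using dim by simp
  then obtain x c where x: "g \<cdot> x = x" "x \<cdot> x = c *\<^sub>R g" "c \<in> {-1, 0, 1}" "indep2 g x"
    by (rule unital_dim_2_basis[OF g(1)])
  have fx: "f \<cdot> x = 0"
    by (metis x(1) g(2) assoc zero_left)
  have ind: "indep3 e f x"
    unfolding indep3_def
  proof (intro allI impI)
    fix a b d assume abd: "a *\<^sub>R e + b *\<^sub>R f + d *\<^sub>R x = 0"
    have "a *\<^sub>R g + d *\<^sub>R x = 0"
      using arg_cong[OF abd, of "\<lambda>z. g \<cdot> z"] by (simp add: expand commute[of g e] unit g x)
    then have "a = 0 \<and> d = 0" using x(4) by (simp add: indep2_def)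
    then show "a = 0 \<and> b = 0 \<and> d = 0" using abd f(2) by simp
  qed
  from x(3) consider "c = -1" | "c = 0" | "c = 1" by auto
  then show ?thesis
  proof cases
    case 1
    then show ?thesis
      by (intro normalizableI[OF _ ind, of 2]) (simp_all add: table unit f x fx, simp add: g_def)
  next
    case 2
    then show ?thesis
      by (intro normalizableI[OF _ ind, of 3]) (simp_all add: table unit f x fx)
  next
    case 3
    define r where "r = (1 / 2) *\<^sub>R (g + x)"
    define s where "s = (1 / 2) *\<^sub>R (g - x)"
    have rs: "r \<cdot> r = r" "s \<cdot> s = s" "r \<cdot> s = 0"
      using 3 by (simp_all add: r_def s_def expand g x commute[of x g] vec_eq_iff field_simps)
    have ind: "indep3 e r s"
      unfolding indep3_def
    proof (intro allI impI)
      fix a b d assume abd: "a *\<^sub>R e + b *\<^sub>R r + d *\<^sub>R s = 0"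
      \<comment> \<open>Rewrites the relation in the basis e, f, x by means of r + s = g = e - f and
        r - s = x.\<close>
      have "(a + (b + d) / 2) *\<^sub>R e + (- (b + d) / 2) *\<^sub>R f + ((b - d) / 2) *\<^sub>R x =
          a *\<^sub>R e + b *\<^sub>R r + d *\<^sub>R s"
        by (simp add: r_def s_def g_def vec_eq_iff field_simps)
      then have "a + (b + d) / 2 = 0 \<and> - (b + d) / 2 = 0 \<and> (b - d) / 2 = 0"
        using ind abd unfolding indep3_def by metis
      then show "a = 0 \<and> b = 0 \<and> d = 0" by auto
    qed
    show ?thesis
      by (intro normalizableI[OF _ ind, of 1]) (simp_all add: table unit rs del: One_nat_def)
  qed
qed

lemma normalizable_unital:
  assumes unit: "\<And>x. e \<cdot> x = x"
  shows normalizable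
proof (cases "\<exists>f. f \<cdot> f = f \<and> f \<noteq> 0 \<and> f \<noteq> e")
  case True
  then obtain f where f: "f \<cdot> f = f" "f \<noteq> 0" "f \<noteq> e" by blast
  define g where "g = e - f"
  have fe: "f \<cdot> e = f" using unit[of f] by (simp only: commute)
  have g: "g \<cdot> g = g" "g \<noteq> 0"
    using f by (simp_all add: g_def expand unit fe)
  let ?F = "{x. f \<cdot> x = x}" and ?G = "{x. f \<cdot> x = 0}"
  have G: "{x. g \<cdot> x = 0} = ?F" by (auto simp: g_def expand unit)
  have "f \<cdot> g = 0" by (simp add: g_def expand fe f)
  then have "dim ?F \<noteq> 0" "dim ?G \<noteq> 0"
    using f g(2) by (auto simp: dim_eq_0)
  moreover have "dim ?F + dim ?G = 3" by (rule peirce_dim[OF f(1)])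
  \<comment> \<open>Two positive ranks with sum 3; the idempotent of rank 1 is the one to split off,
    either \<open>f\<close> or \<open>g\<close>.\<close>
  ultimately consider "dim ?G = 2" | "dim ?F = 2" by linarith
  then show ?thesis
  proof cases
    case 1
    with unit f show ?thesis by (intro normalizable_unital_split[of e f])
  next
    case 2
    with unit g show ?thesis by (intro normalizable_unital_split[of e g]) (simp_all add: G)
  qed
next
  case False
  then have idem: "f = e" if "f \<cdot> f = f" "f \<noteq> 0" for f using that by blast
  have xe: "x \<cdot> e = x" for x using unit[of x] by (simp only: commute)
  have "e \<noteq> 0"
  proof
    assume "e = 0"
    then have "x = 0" for x :: "real ^ 3" using unit[of x] by simp
    from this[of "vector [1, 0, 0]"] show False by (simp add: vec_eq_iff forall_3)
  qed
  let ?N = "{x. nil4 x}"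
  \<comment> \<open>A non-nilpotent element has a nonzero idempotent multiple, which can only be
    \<open>e\<close>.\<close>
  have inverse: "nil4 y" if "\<And>z. y \<cdot> z \<noteq> e" for y
    by (rule nil4_or_idempotent[of y]) (use idem that in blast)+
  \<comment> \<open>Otherwise \<open>x z + y z = e\<close> for some \<open>z\<close>, so \<open>e - t\<close> with \<open>t = x z\<close> would be both nilpotent and invertible.\<close>
  have nil_add: "nil4 (x + y)" if "nil4 x" "nil4 y" for x y
  proof (rule inverse, rule notI)
    fix z assume z: "(x + y) \<cdot> z = e"
    define t where "t = x \<cdot> z"
    have t: "nil4 t" using that(1) unfolding t_def by (rule nil4_mult)
    have "y \<cdot> z = e - t" using z by (simp add: t_def expand algebra_simps)
    with nil4_mult[OF that(2), of z] have "nil4 (e - t)" by simp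
    then have "nil4 ((e - t) \<cdot> (e + t + t \<cdot> t + t \<cdot> (t \<cdot> t)))" by (rule nil4_mult)
    moreover have "(e - t) \<cdot> (e + t + t \<cdot> t + t \<cdot> (t \<cdot> t)) = e"
      using t by (simp add: expand unit xe)
    ultimately show False using \<open>e \<noteq> 0\<close> by (simp add: unit)
  qed
  have sub: "subspace ?N"
    using nil_add nil4_scaleR by (simp add: subspace_def)
  have "e \<notin> ?N" using \<open>e \<noteq> 0\<close> by (simp add: unit)
  \<comment> \<open>Subtracting a real eigenvalue leaves an element that kills a nonzero vector,
    hence is not invertible and so nilpotent.\<close>
  have "x \<in> span (insert e ?N)" for x
  proof -
    obtain c v where v: "v \<noteq> 0" "x \<cdot> v = c *\<^sub>R v"
      using linear_real_3_has_eigenvector[OF bilinear_linear_right[OF bilinear, of x]] .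
    have "(x - c *\<^sub>R e) \<cdot> v = 0" by (simp add: expand unit v)
    then have "nil4 (x - c *\<^sub>R e)"
      using v(1) by (intro inverse) (metis assoc commute unit zero_left)
    then have "(x - c *\<^sub>R e) + c *\<^sub>R e \<in> span (insert e ?N)"
      by (intro span_add span_scale) (auto intro: span_base)
    then show ?thesis by simp
  qed
  then have "span (insert e ?N) = UNIV" by blast
  then have "dim (insert e ?N) = 3"
    using arg_cong[of _ _ dim] dim_span[of "insert e ?N"] by (simp add: dim_UNIV)
  moreover have "e \<notin> span ?N"
    unfolding span_eq_iff[THEN iffD2, OF sub] by (rule \<open>e \<notin> ?N\<close>)
  ultimately have dim: "dim ?N = 2" by (simp add: dim_insert)
  have nil: "nil4 x" if "x \<in> ?N" for x using that by simp
  have closed: "x \<cdot> y \<in> ?N" if "x \<in> ?N" "y \<in> ?N" for x y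
    using that nil4_mult by blast
  obtain u v where uv: "u \<in> ?N" "v \<in> ?N" "indep2 u v" "u \<cdot> v = 0" "v \<cdot> v = 0"
    "u \<cdot> u = v \<or> u \<cdot> u = 0"
    by (rule nil_dim_2_basis[OF sub dim closed nil])
  have N: "b *\<^sub>R u + c *\<^sub>R v \<in> ?N" for b c
    using uv(1,2) by (intro subspace_add subspace_scale sub)
  have ind: "a = 0 \<and> b = 0 \<and> c = 0" if abc: "a *\<^sub>R e + b *\<^sub>R u + c *\<^sub>R v = 0" for a b c
  proof -
    \<comment> \<open>A multiple of \<open>e\<close> lying in the nil ideal has fourth power a^4 e =
      0.\<close>
    have "a *\<^sub>R e = (- b) *\<^sub>R u + (- c) *\<^sub>R v"
      using abc by (simp add: eq_neg_iff_add_eq_0 algebra_simps)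
    then have "a *\<^sub>R e \<in> ?N" by (simp only: N)
    then have "nil4 (a *\<^sub>R e)" by simp
    then have "a = 0" using \<open>e \<noteq> 0\<close> by (simp add: expand unit)
    then show ?thesis using abc uv(3) by (simp add: indep2_def)
  qed
  from uv(6) show ?thesis
  proof
    assume "u \<cdot> u = v"
    \<comment> \<open>Form 4 has its generator in third position and the square of the generator in
      second, hence the exchange of \<open>u\<close> and \<open>v\<close>.\<close>
    have "indep3 e v u"
      unfolding indep3_def
    proof (intro allI impI)
      fix a b c assume "a *\<^sub>R e + b *\<^sub>R v + c *\<^sub>R u = 0"
      then have "a *\<^sub>R e + c *\<^sub>R u + b *\<^sub>R v = 0" by (simp only: ac_simps)
      then show "a = 0 \<and> b = 0 \<and> c = 0" using ind by blast
    qed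
    then show ?thesis using \<open>u \<cdot> u = v\<close>
      by (intro normalizableI[OF _ \<open>indep3 e v u\<close>, of 4]) (simp_all add: table unit uv commute[of v u])
  next
    assume "u \<cdot> u = 0"
    have "indep3 e u v"
      using ind by (simp add: indep3_def)
    then show ?thesis using \<open>u \<cdot> u = 0\<close>
      by (intro normalizableI[OF _ \<open>indep3 e u v\<close>, of 5]) (simp_all add: table unit uv)
  qed
qed

theorem normalizable: normalizable
proof -
  obtain e where e: "e \<cdot> e = e" and max: "\<And>f. f \<cdot> f = f \<Longrightarrow> e \<cdot> f = 0 \<Longrightarrow> f = 0"
    using obtain_maximal_idempotent by blast
  let ?S = "{x. e \<cdot> x = x}"
  have "dim ?S \<le> 3"
    using peirce_dim[OF e] by simp
  then consider "dim ?S = 0" | "dim ?S = 1" | "dim ?S = 2" | "dim ?S = 3"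
    by linarith
  then show ?thesis
  proof cases
    case 1
    \<comment> \<open>\<open>e\<close> lies in its own fixed space; once it is 0, maximality says
      that there is no nonzero idempotent at all.\<close>
    then have "e = 0" using e by (auto simp: dim_eq_0)
    have "nil4 x" for x
      by (rule nil4_or_idempotent[of x]) (use max \<open>e = 0\<close> in auto)
    then show ?thesis by (rule normalizable_nil)
  next
    case 2
    with e max show ?thesis by (rule normalizable_rank_1)
  next
    case 3
    with e max show ?thesis by (rule normalizable_rank_2)
  next
    case 4
    then have "span ?S = UNIV"
      using dim_eq_full[of ?S] by simp
    then have "?S = UNIV"
      using span_eq_iff[THEN iffD2, OF eigenspace_subspace(1)[of e]] by simp
    then show ?thesis by (intro normalizable_unital[of e]) auto
  qed
qed

end

subsection \<open>Equivalence classes\<close>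

lemma affine_equivalence_iff:
  fixes \<Psi> \<Phi> :: "'g::real_vector \<Rightarrow> 'n::finite block_matrix"
  shows "(\<Psi>, \<Phi>) \<in> affine_equivalence \<longleftrightarrow>
    affine_structure abelian_bracket \<Psi> \<and> affine_structure abelian_bracket \<Phi> \<and>
    (\<exists>f. algebra_isomorphism (affine_product \<Psi>) (affine_product \<Phi>) f)"
  by (simp add: affine_equivalence_def algebra_isomorphism_def)

lemma algebra_isomorphism_inv:
  assumes "algebra_isomorphism p q f"
  shows "algebra_isomorphism q p (inv f)"
proof -
  have f: "linear f" "bij f" "\<And>x y. f (p x y) = q (f x) (f y)"
    using assms by (auto simp: algebra_isomorphism_def)
  have inv: "inv f z = x \<longleftrightarrow> z = f x" for x z
    using f(2) by (metis bij_inv_eq_iff)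
  have "linear (inv f)"
    using f(1,2) by (auto simp: linear_iff inv bij_is_surj surj_f_inv_f)
  then show ?thesis
    using f by (auto simp: algebra_isomorphism_def bij_imp_bij_inv inv bij_is_surj surj_f_inv_f)
qed

lemma equiv_affine_equivalence:
  "equiv {\<Psi> :: 'g::real_vector \<Rightarrow> 'n::finite block_matrix. affine_structure abelian_bracket \<Psi>} affine_equivalence"
proof (rule equivI)
  show "refl_on {\<Psi> :: 'g \<Rightarrow> 'n block_matrix. affine_structure abelian_bracket \<Psi>} affine_equivalence"
    by (auto simp: refl_on_def affine_equivalence_iff algebra_isomorphism_def linear_id intro!: exI[of _ id])
  show "sym (affine_equivalence :: (('g \<Rightarrow> 'n block_matrix) \<times> _) set)"
    by (rule symI) (auto simp: affine_equivalence_iff dest: algebra_isomorphism_inv)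
  show "trans (affine_equivalence :: (('g \<Rightarrow> 'n block_matrix) \<times> _) set)"
  proof (rule transI)
    fix \<Psi> \<Phi> \<Theta> :: "'g \<Rightarrow> 'n block_matrix"
    assume 1: "(\<Psi>, \<Phi>) \<in> affine_equivalence" "(\<Phi>, \<Theta>) \<in> affine_equivalence"
    then obtain f g where "algebra_isomorphism (affine_product \<Psi>) (affine_product \<Phi>) f"
      "algebra_isomorphism (affine_product \<Phi>) (affine_product \<Theta>) g"
      by (auto simp: affine_equivalence_iff)
    then have "algebra_isomorphism (affine_product \<Psi>) (affine_product \<Theta>) (g \<circ> f)"
      by (auto simp: algebra_isomorphism_def linear_compose bij_comp)
    with 1 show "(\<Psi>, \<Theta>) \<in> affine_equivalence"
      by (auto simp: affine_equivalence_iff)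
  qed
qed (auto simp: affine_equivalence_iff)

text \<open>Injectivity holds because \<open>kind\<close> recovers the index from the isomorphism
  type; surjectivity is the reduction to normal form applied to the product of a
  representative.\<close>

lemma bij_betw_normal_classes:
  "bij_betw (\<lambda>i. affine_equivalence `` {product_structure (normal_product i)}) {1..15}
    ({\<Psi>. affine_structure abelian_bracket \<Psi>} // affine_equivalence)"
proof -
  let ?A = "\<lambda>i. product_structure (normal_product i)"
  have ca: "commutative_associative (normal_product i)" if "i \<in> {1..15}" for i
    using that by (rule commutative_associative_normal_product)
  have A: "affine_structure abelian_bracket (?A i)" "affine_product (?A i) = normal_product i"
    if "i \<in> {1..15}" for i
    using ca[OF that] by (simp_all add: affine_structure_product_structure
        affine_product_product_structure commutative_associative.bilinear)
  note class_eq = eq_equiv_class_iff[OF equiv_affine_equivalence]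
  show ?thesis
    unfolding bij_betw_def
  proof
    show "inj_on (\<lambda>i. affine_equivalence `` {?A i}) {1..15}"
    proof (rule inj_onI)
      fix i j :: nat
      assume ij: "i \<in> {1..15}" "j \<in> {1..15}"
        and "affine_equivalence `` {?A i} = affine_equivalence `` {?A j}"
      then have "(?A i, ?A j) \<in> affine_equivalence"
        using class_eq A(1) by blast
      then obtain f where "algebra_isomorphism (normal_product i) (normal_product j) f"
        using ij by (auto simp: affine_equivalence_iff A)
      then have "kind (normal_product i) = kind (normal_product j)"
        by (rule kind_eq_if_isomorphic)
      with ij show "i = j" by (simp only: kind_normal_product)
    qed
    show "(\<lambda>i. affine_equivalence `` {?A i}) ` {1..15} =
      {\<Psi>. affine_structure abelian_bracket \<Psi>} // affine_equivalence"
    proof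
      show "(\<lambda>i. affine_equivalence `` {?A i}) ` {1..15} \<subseteq>
        {\<Psi>. affine_structure abelian_bracket \<Psi>} // affine_equivalence"
        using A(1) by (auto intro!: quotientI)
      show "{\<Psi>. affine_structure abelian_bracket \<Psi>} // affine_equivalence \<subseteq>
        (\<lambda>i. affine_equivalence `` {?A i}) ` {1..15}"
      proof
        fix C :: "(real ^ 3 \<Rightarrow> 3 block_matrix) set"
        assume "C \<in> {\<Psi>. affine_structure abelian_bracket \<Psi>} // affine_equivalence"
        then obtain \<Psi> where \<Psi>: "affine_structure abelian_bracket \<Psi>" "C = affine_equivalence `` {\<Psi>}"
          by (auto elim: quotientE)
        interpret algebra3 "affine_product \<Psi>"
          using commutative_associative_affine_product[OF \<Psi>(1)] by (simp add: algebra3_def)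
        obtain i f where i: "i \<in> {1..15}" "algebra_isomorphism (normal_product i) (affine_product \<Psi>) f"
          using normalizable by (auto simp: normalizable_def)
        then have "(?A i, \<Psi>) \<in> affine_equivalence"
          using \<Psi>(1) by (auto simp: affine_equivalence_iff A)
        then have "affine_equivalence `` {?A i} = C"
          using equiv_class_eq[OF equiv_affine_equivalence] \<Psi>(2) by blast
        with i(1) show "C \<in> (\<lambda>i. affine_equivalence `` {?A i}) ` {1..15}" by blast
      qed
    qed
  qed
qed

theorem theorem5p2:
  "card ({\<Psi> :: real ^ 3 \<Rightarrow> 3 block_matrix. affine_structure abelian_bracket \<Psi>} //
      affine_equivalence) = 15 \<and>
   (\<exists>A :: nat \<Rightarrow> real ^ 3 \<Rightarrow> 3 block_matrix.
      (\<forall>i\<in>{1..15}. affine_structure abelian_bracket (A i)) \<and>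
      (\<forall>a b c x y z :: real.
        affine_action (A 1) (vector [a, b, c]) (vector [x, y, z]) = vector
          [exp a * x + exp a - 1,
           exp a * (exp b - 1) * x + exp (a + b) * y + exp a * (exp b - 1),
           exp a * (exp c - 1) * x + exp (a + c) * z + exp a * (exp c - 1)] \<and>
        affine_action (A 2) (vector [a, b, c]) (vector [x, y, z]) = vector
          [x * exp a * cos c - z * exp a * sin c + exp a * cos c - 1,
           (exp (a + b) - exp a * cos c) * x + exp (a + b) * y + z * exp a * sin c
             - exp a * cos c + exp (a + b),
           x * exp a * sin c + z * exp a * cos c + exp a * sin c] \<and>
        affine_action (A 3) (vector [a, b, c]) (vector [x, y, z]) = vector
          [exp a * x + exp a - 1,
           exp a * (exp b - 1) * x + exp (a + b) * y + exp a * (exp b - 1),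
           c * exp a * x + exp a * z + c * exp a] \<and>
        affine_action (A 4) (vector [a, b, c]) (vector [x, y, z]) = vector
          [exp a * x + exp a - 1,
           (b + c^2 / 2) * exp a * x + exp a * y + c * exp a * z + (b + c^2 / 2) * exp a,
           c * exp a * x + exp a * z + c * exp a] \<and>
        affine_action (A 5) (vector [a, b, c]) (vector [x, y, z]) = vector
          [exp a * x + exp a - 1,
           b * exp a * x + exp a * y + b * exp a,
           c * exp a * x + exp a * z + c * exp a] \<and>
        affine_action (A 6) (vector [a, b, c]) (vector [x, y, z]) = vector
          [exp a * x + exp a - 1,
           exp b * y + exp b - 1,
           z + c] \<and>
        affine_action (A 7) (vector [a, b, c]) (vector [x, y, z]) = vector
          [x * exp a * cos b - y * exp a * sin b + exp a * cos b - 1,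
           x * exp a * sin b + y * exp a * cos b + exp a * sin b,
           z + c] \<and>
        affine_action (A 8) (vector [a, b, c]) (vector [x, y, z]) = vector
          [exp a * x + exp a - 1,
           y + b,
           z + c] \<and>
        affine_action (A 9) (vector [a, b, c]) (vector [x, y, z]) = vector
          [exp a * x + exp a - 1,
           b * exp a * x + exp a * y + b * exp a,
           z + c] \<and>
        affine_action (A 10) (vector [a, b, c]) (vector [x, y, z]) = vector
          [exp a * x + exp a - 1,
           y + b,
           b * y + z + b^2 / 2 + c] \<and>
        affine_action (A 11) (vector [a, b, c]) (vector [x, y, z]) = vector
          [x + a,
           a * x + y + c * z + b + 1 / 2 * (a^2 + c^2),
           z + c] \<and>
        affine_action (A 12) (vector [a, b, c]) (vector [x, y, z]) = vector
          [x + a,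
           a * x + y - c * z + b + 1 / 2 * (a^2 - c^2),
           z + c] \<and>
        affine_action (A 13) (vector [a, b, c]) (vector [x, y, z]) = vector
          [x + a,
           a * x + y + b + a^2 / 2,
           z + c] \<and>
        affine_action (A 14) (vector [a, b, c]) (vector [x, y, z]) = vector
          [x + a,
           a * x + y + b + a^2 / 2,
           (b + a^2 / 2) * x + a * y + z + a^3 / 6 + a * b + c] \<and>
        affine_action (A 15) (vector [a, b, c]) (vector [x, y, z]) = vector
          [x + a,
           y + b,
           z + c]) \<and>
      bij_betw (\<lambda>i. affine_equivalence `` {A i}) {1..15}
        ({\<Psi>. affine_structure abelian_bracket \<Psi>} // affine_equivalence) \<and>
      (\<forall>i\<in>{1..15}. complete_structure (A i) \<longleftrightarrow> i \<in> {11..15}))"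
proof (rule conjI)
  show "card ({\<Psi> :: real ^ 3 \<Rightarrow> 3 block_matrix. affine_structure abelian_bracket \<Psi>} //
      affine_equivalence) = 15"
    using bij_betw_same_card[OF bij_betw_normal_classes] by simp
qed (intro exI[of _ "\<lambda>i. product_structure (normal_product i)"] conjI allI,
    use affine_structure_product_structure commutative_associative_normal_product in blast,
    (rule affine_action_normal_products)+,
    rule bij_betw_normal_classes,
    use complete_structure_normal_product in blast)

end
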